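(* Let $\mathcal{A}$ be an essential real hyperplane arrangement in $\mathbb{R}^d$ given by linear forms $\ell_1,\dots,\ell_t$, with real face semigroup $F$ and intersection lattice $L$ (ordered by inclusion, bottom $\{0\}$, top $\hat 1=\mathbb{R}^d$, Möbius function $\mu_L$). Let $\mathrm{Int}(F)=\{[Y,X]:Y,X\in F,\ Y\le X\}$ with composition $[Y,X]\circ[R,S]=[Y\circ R,\ Y\circ R\circ X\circ S]$, and support map $\mathrm{supp}([Y,X])=(\mathrm{span}(Y),\mathrm{span}(X))\in\mathrm{Int}(L)$. Fix $\pi\in L$ and let $\mathrm{Fib}=\{[Y,X]\in\mathrm{Int}(F):\mathrm{span}(Y)\subseteq\pi\}$, with maximal elements $\max(\mathrm{Fib})=\{[Y,X]:\mathrm{span}(Y)=\pi,\ \mathrm{span}(X)=\mathbb{R}^d\}$. Let $w=(w_x)_{x\in\mathrm{Fib}}$ be a probability distribution on $\mathrm{Fib}$ and $P_w(c,d)=\sum_{x\in\mathrm{Fib}:\ x\circ c=d}w_x$ for $c,d\in\max(\mathrm{Fib})$ the transition matrix of the walk on $\max(\mathrm{Fib})$ (from $c$, choose $x$ according to $w$ and move to $x\circ c$). Then: (1) $P_w$ is diagonalizable. (2) For each pair $(\alpha,\beta)$ with $\alpha,\beta\in L$ and $\alpha\subseteq\pi\subseteq\beta$ there is an eigenvalue $\varepsilon_{(\alpha,\beta)}=\sum w_{[Y,X]}$, the sum over $[Y,X]\in\mathrm{Fib}$ with $\mathrm{span}(Y)\subseteq\alpha$ and $\mathrm{span}(X)\subseteq\beta$.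 (3) The multiplicity of $\varepsilon_{(\alpha,\beta)}$ is $|\mu_L(\alpha,\pi)\,\mu_L(\beta,\hat 1)|$. (4) These are all the eigenvalues of $P_w$. (5) If $\mathrm{Fib}$ is generated as a semigroup by $\{x\in\mathrm{Fib}:w_x>0\}$, then the walk on $\max(\mathrm{Fib})$ has a unique stationary distribution.
   Context: For $x\in\mathbb{R}^d$, the sign vector $\sigma(x)\in\{0,+,-\}^t$ has $k$-th entry $0,+,-$ according as $\ell_k(x)=0$, $>0$, $<0$; $F=\sigma(\mathbb{R}^d)$, ordered componentwise with $0<+$, $0<-$. Composition: $(X\circ Y)_k=X_k$ if $X_k\neq0$, and $Y_k$ if $X_k=0$. The arrangement is essential: $\bigcap_k\{\ell_k=0\}=\{0\}$. $L$ is the set of intersections of subfamilies of the hyperplanes $\{\ell_k=0\}$ (empty intersection $\mathbb{R}^d$), ordered by inclusion; $\mathrm{span}(X)$ is the linear span of the cone $\sigma^{-1}(X)$, i.e. the intersection of the hyperplanes $\{\ell_k=0\}$ with $X_k=0$. $\mathrm{Int}(L)=\{(\alpha,\beta):\alpha\subseteq\beta\}$ is ordered componentwise. (When the $\ell_k$ are viewed as forms on $\mathbb{C}^d$, $\mathrm{Int}(F)$ with this composition is isomorphic to the face semigroup of the complexified arrangement, and $\mathrm{Fib}$ is the set of elements whose support is $\le(\pi,\hat 1)$.) *)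

theory Defs
  imports
    "HOL-Analysis.Analysis"
    "Jordan_Normal_Form.Char_Poly"
begin

datatype sign = Zero | Pos | Neg

instantiation sign :: order
begin

definition less_eq_sign :: "sign \<Rightarrow> sign \<Rightarrow> bool" where
  "less_eq_sign a b \<longleftrightarrow> a = Zero \<or> a = b"

definition less_sign :: "sign \<Rightarrow> sign \<Rightarrow> bool" where
  "less_sign a b \<longleftrightarrow> a = Zero \<and> b \<noteq> Zero"

instance
  by standard (auto simp: less_eq_sign_def less_sign_def)

end

text \<open>
  Sign vectors are functions from the finite index type of the forms into \<^typ>\<open>sign\<close>; the
  componentwise order on them is the library order on functions.
\<close>

type_synonym 't face = "'t \<Rightarrow> sign"

definition sign_of :: "real \<Rightarrow> sign" where
  "sign_of r = (if r = 0 then Zero else if r > 0 then Pos else Neg)"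

definition sign_vector :: "('t \<Rightarrow> real^'d \<Rightarrow> real) \<Rightarrow> real^'d \<Rightarrow> 't face" where
  "sign_vector l x = (\<lambda>k. sign_of (l k x))"

definition faces :: "('t \<Rightarrow> real^'d \<Rightarrow> real) \<Rightarrow> 't face set" where
  "faces l = range (sign_vector l)"

definition face_comp :: "'t face \<Rightarrow> 't face \<Rightarrow> 't face" (infixl "\<circ>\<^sub>F" 70) where
  "X \<circ>\<^sub>F Y = (\<lambda>k. if X k \<noteq> Zero then X k else Y k)"

definition zero_set :: "('t \<Rightarrow> real^'d \<Rightarrow> real) \<Rightarrow> 't \<Rightarrow> (real^'d) set" where
  "zero_set l k = {x. l k x = 0}"

definition arrangement :: "('t::finite \<Rightarrow> real^'d \<Rightarrow> real) \<Rightarrow> bool" where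
  "arrangement l \<longleftrightarrow> (\<forall>k. linear (l k) \<and> l k \<noteq> (\<lambda>x. 0))"

definition essential :: "('t::finite \<Rightarrow> real^'d \<Rightarrow> real) \<Rightarrow> bool" where
  "essential l \<longleftrightarrow> (\<Inter>k. zero_set l k) = {0}"

definition flats :: "('t \<Rightarrow> real^'d \<Rightarrow> real) \<Rightarrow> (real^'d) set set" where
  "flats l = range (\<lambda>S. \<Inter>k\<in>S. zero_set l k)"

definition face_span :: "('t \<Rightarrow> real^'d \<Rightarrow> real) \<Rightarrow> 't face \<Rightarrow> (real^'d) set" where
  "face_span l X = span {x. sign_vector l x = X}"

text \<open>The Moebius function of a finite subset of an ordered type, with the induced order.\<close>

function poset_moebius :: "'a::order set \<Rightarrow> 'a \<Rightarrow> 'a \<Rightarrow> int" where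
  "poset_moebius P x y =
     (if finite P \<and> x \<in> P \<and> y \<in> P \<and> x \<le> y
      then if x = y then 1 else - (\<Sum>z\<in>{z\<in>P. x \<le> z \<and> z < y}. poset_moebius P x z)
      else 0)"
  by pat_completeness auto
termination
proof (relation "Wellfounded.measure (\<lambda>(P, x, y). card {z\<in>P. z < y})", goal_cases)
  case 1
  show ?case by simp
next
  case (2 P x y z)
  have "{u\<in>P. u < z} \<subset> {u\<in>P. u < y}"
    using 2 by (auto intro: less_trans)
  then show ?case
    using 2 by (auto intro!: psubset_card_mono)
qed

declare poset_moebius.simps [simp del]

text \<open>The interval \<open>[Y, X]\<close> is the pair \<open>(Y, X)\<close>.\<close>

type_synonym 't face_interval = "'t face \<times> 't face"

definition int_faces :: "('t \<Rightarrow> real^'d \<Rightarrow> real) \<Rightarrow> 't face_interval set" where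
  "int_faces l = {(Y, X). Y \<in> faces l \<and> X \<in> faces l \<and> Y \<le> X}"

fun int_comp :: "'t face_interval \<Rightarrow> 't face_interval \<Rightarrow> 't face_interval" (infixl "\<circ>\<^sub>I" 70) where
  "(Y, X) \<circ>\<^sub>I (R, S) = (Y \<circ>\<^sub>F R, Y \<circ>\<^sub>F R \<circ>\<^sub>F X \<circ>\<^sub>F S)"

fun int_supp :: "('t \<Rightarrow> real^'d \<Rightarrow> real) \<Rightarrow> 't face_interval \<Rightarrow> (real^'d) set \<times> (real^'d) set" where
  "int_supp l (Y, X) = (face_span l Y, face_span l X)"

definition fib :: "('t \<Rightarrow> real^'d \<Rightarrow> real) \<Rightarrow> (real^'d) set \<Rightarrow> 't face_interval set" where
  "fib l \<pi> = {x \<in> int_faces l. fst (int_supp l x) \<subseteq> \<pi>}"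

definition max_fib :: "('t \<Rightarrow> real^'d \<Rightarrow> real) \<Rightarrow> (real^'d) set \<Rightarrow> 't face_interval set" where
  "max_fib l \<pi> = {x \<in> int_faces l. int_supp l x = (\<pi>, UNIV)}"

text \<open>
  A family indexed by \<open>A\<close> is represented by its extension by zero, so that distinct functions are
  distinct distributions.
\<close>

definition distribution_on :: "'a set \<Rightarrow> ('a \<Rightarrow> real) \<Rightarrow> bool" where
  "distribution_on A p \<longleftrightarrow>
     (\<forall>x\<in>A. 0 \<le> p x) \<and> (\<forall>x. x \<notin> A \<longrightarrow> p x = 0) \<and> (\<Sum>x\<in>A. p x) = 1"

definition walk_prob ::
  "('t \<Rightarrow> real^'d \<Rightarrow> real) \<Rightarrow> (real^'d) set \<Rightarrow> ('t face_interval \<Rightarrow> real)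
     \<Rightarrow> 't face_interval \<Rightarrow> 't face_interval \<Rightarrow> real" where
  "walk_prob l \<pi> w c d = (\<Sum>x\<in>{x \<in> fib l \<pi>. x \<circ>\<^sub>I c = d}. w x)"

text \<open>The list \<open>cs\<close> is meant to enumerate \<^term>\<open>max_fib l \<pi>\<close> without repetitions.\<close>

definition walk_matrix ::
  "('t \<Rightarrow> real^'d \<Rightarrow> real) \<Rightarrow> (real^'d) set \<Rightarrow> ('t face_interval \<Rightarrow> real)
     \<Rightarrow> 't face_interval list \<Rightarrow> real Matrix.mat" where
  "walk_matrix l \<pi> w cs =
     Matrix.mat (length cs) (length cs) (\<lambda>(i, j). walk_prob l \<pi> w (cs ! i) (cs ! j))"

definition diagonalizable :: "'a::comm_ring_1 Matrix.mat \<Rightarrow> bool" where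
  "diagonalizable A \<longleftrightarrow> (\<exists>D. diagonal_mat D \<and> similar_mat A D)"

definition flat_pairs ::
  "('t \<Rightarrow> real^'d \<Rightarrow> real) \<Rightarrow> (real^'d) set \<Rightarrow> ((real^'d) set \<times> (real^'d) set) set" where
  "flat_pairs l \<pi> = {(\<alpha>, \<beta>). \<alpha> \<in> flats l \<and> \<beta> \<in> flats l \<and> \<alpha> \<subseteq> \<pi> \<and> \<pi> \<subseteq> \<beta>}"

definition walk_eigenvalue ::
  "('t \<Rightarrow> real^'d \<Rightarrow> real) \<Rightarrow> (real^'d) set \<Rightarrow> ('t face_interval \<Rightarrow> real)
     \<Rightarrow> (real^'d) set \<Rightarrow> (real^'d) set \<Rightarrow> real" where
  "walk_eigenvalue l \<pi> w \<alpha> \<beta> =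
     (\<Sum>x\<in>{x \<in> fib l \<pi>. fst (int_supp l x) \<subseteq> \<alpha> \<and> snd (int_supp l x) \<subseteq> \<beta>}. w x)"

inductive_set generated_semigroup :: "'t face_interval set \<Rightarrow> 't face_interval set"
  for G :: "'t face_interval set" where
  base: "x \<in> G \<Longrightarrow> x \<in> generated_semigroup G"
| mult: "x \<in> generated_semigroup G \<Longrightarrow> y \<in> generated_semigroup G
          \<Longrightarrow> x \<circ>\<^sub>I y \<in> generated_semigroup G"

definition stationary ::
  "('t \<Rightarrow> real^'d \<Rightarrow> real) \<Rightarrow> (real^'d) set \<Rightarrow> ('t face_interval \<Rightarrow> real)
     \<Rightarrow> ('t face_interval \<Rightarrow> real) \<Rightarrow> bool" where
  "stationary l \<pi> w p \<longleftrightarrow>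
     distribution_on (max_fib l \<pi>) p \<and>
     (\<forall>d\<in>max_fib l \<pi>. (\<Sum>c\<in>max_fib l \<pi>. p c * walk_prob l \<pi> w c d) = p d)"

end

theory Submission
  imports Defs
    "Jordan_Normal_Form.Jordan_Normal_Form_Existence"
    "Jordan_Normal_Form.Jordan_Normal_Form_Uniqueness"
begin

text \<open>
  The interval semigroup is a left regular band, and the walk operator \<open>P\<close> is given by left
  multiplication by \<open>\<Sum>w\<^sub>x x\<close>. For \<open>s\<close> in the band let \<open>\<lambda>\<^sub>s\<close> be the total weight of the \<open>x\<close> with \<open>s x = s\<close>. Multiplying
  \<open>s\<close> by \<open>\<Sum>w\<^sub>x x - \<lambda>\<^sub>s\<close> only leaves elements \<open>s x\<close> with \<open>\<lambda>\<close> strictly larger, because the weights are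
  nonnegative. Hence a product of pairwise distinct factors \<open>P - \<lambda>\<close> vanishes, and \<open>P\<close> is diagonalizable.

  The multiplicities follow from the traces of the powers of \<open>P\<close>. They reduce to counting the maximal
  elements fixed by \<open>[Y, X]\<close>: these are pairs of a face above \<open>Y\<close> spanning \<open>\<pi>\<close> and a chamber above
  another face. Zaslavsky's formula, proved by an Euler characteristic computation, counts both
  in terms of the Moebius function, whose sign alternates by Rota's theorem.
\<close>

text \<open>Different pairs (\<alpha>, \<beta>) may give the same number, so eigenvectors are not
  built pair by pair: diagonalizability and spectrum are obtained separately. In Fib the number
  \<lambda> of s is the total weight of the elements whose support lies below that of s. The second
  component of a support need not contain \<pi>, so the annihilating product may include factors for
  numbers that are not eigenvalues. This does no harm: distinct factors suffice for
  diagonalizability, and the traces select the true spectrum. The traces of the powers alone do not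
  admit an induction. The trace of P^k combined with left multiplication by s does, because one step
  replaces s by s x. A pair lies above the support of s x exactly if it lies above both supports, so
  each step contributes one more factor \<epsilon>, and the fixed points of s are the initial
  values. The condition \<pi> \<subseteq> \<beta> arises because the chamber of a maximal element
  lies above a face spanning \<pi>.\<close>

hide_const (open) VectorSpace.subspace
hide_fact (open) VectorSpace.subspace_def

section \<open>Moebius functions\<close>

lemma sum_moebius_upper:
  fixes P :: "'a::order set"
  assumes "finite P" "x \<in> P" "y \<in> P" "x \<le> y"
  shows "(\<Sum>z\<in>{z\<in>P. x \<le> z \<and> z \<le> y}. poset_moebius P x z) = (if x = y then 1 else 0)"
proof (cases "x = y")
  case True
  then have "{z\<in>P. x \<le> z \<and> z \<le> y} = {x}" using assms by auto
  then show ?thesis using True assms by (simp add: poset_moebius.simps[of P y y])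
next
  case False
  have "{z\<in>P. x \<le> z \<and> z \<le> y} = insert y {z\<in>P. x \<le> z \<and> z < y}"
    using assms by (auto simp: le_less)
  then show ?thesis
    using False assms by (simp add: poset_moebius.simps[of P x y])
qed

text \<open>
  The defining recursion says \<open>\<mu> * \<zeta> = \<delta>\<close> in the incidence algebra. With \<open>f = \<zeta> * \<mu>\<close> this gives
  \<open>\<mu> * f = \<mu>\<close>, from which \<open>f = \<delta>\<close> is read off by downward induction.
\<close>

lemma sum_moebius_lower:
  fixes P :: "'a::order set"
  assumes "finite P" "y \<in> P" "x \<in> P" "x \<le> y"
  shows "(\<Sum>z\<in>{z\<in>P. x \<le> z \<and> z \<le> y}. poset_moebius P z y) = (if x = y then 1 else 0)"
  using assms(3,4)
proof (induction "card {z\<in>P. x < z}" arbitrary: x rule: less_induct)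
  case less
  let ?\<mu> = "poset_moebius P"
  let ?I = "\<lambda>a b. {z\<in>P. a \<le> z \<and> z \<le> b}"
  define f where "f x = (\<Sum>z\<in>?I x y. ?\<mu> z y)" for x
  have fin: "finite (?I a b)" for a b using assms(1) by simp
  have "(\<Sum>z\<in>?I x y. ?\<mu> x z * f z) = (\<Sum>z\<in>?I x y. \<Sum>u\<in>{u\<in>?I x y. z \<le> u}. ?\<mu> x z * ?\<mu> u y)"
    unfolding f_def sum_distrib_left by (intro sum.cong refl) (auto intro: order_trans)
  also have "\<dots> = (\<Sum>u\<in>?I x y. \<Sum>z\<in>{z\<in>?I x y. z \<le> u}. ?\<mu> x z * ?\<mu> u y)"
    by (rule sum.swap_restrict[OF fin fin])
  also have "\<dots> = (\<Sum>u\<in>?I x y. (\<Sum>z\<in>?I x u. ?\<mu> x z) * ?\<mu> u y)"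
    unfolding sum_distrib_right by (intro sum.cong refl) (auto intro: order_trans)
  also have "\<dots> = (\<Sum>u\<in>?I x y. if x = u then ?\<mu> u y else 0)"
    using less.prems by (intro sum.cong refl) (simp add: sum_moebius_upper[OF assms(1)])
  also have "\<dots> = ?\<mu> x y" using less.prems fin by simp
  finally have conv: "(\<Sum>z\<in>?I x y. ?\<mu> x z * f z) = ?\<mu> x y" .
  have split: "?I x y = insert x {z\<in>P. x < z \<and> z \<le> y}"
    using less.prems by (auto simp: le_less)
  have IH: "f z = (if z = y then 1 else 0)" if z: "z \<in> P" "x < z" "z \<le> y" for z
    unfolding f_def
  proof (rule less.hyps)
    have "{u \<in> P. z < u} \<subset> {z \<in> P. x < z}" using z by (auto intro: less_trans)
    then show "card {u \<in> P. z < u} < card {z \<in> P. x < z}"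
      using assms(1) by (intro psubset_card_mono) auto
  qed (use z in auto)
  have "(\<Sum>z\<in>?I x y. ?\<mu> x z * f z) = f x + (\<Sum>z\<in>{z\<in>P. x < z \<and> z \<le> y}. ?\<mu> x z * f z)"
    unfolding split using assms(1) less.prems by (simp add: poset_moebius.simps[of P x x])
  also have "\<dots> = f x + (\<Sum>z\<in>{z\<in>P. x < z \<and> z \<le> y}. if z = y then ?\<mu> x y else 0)"
    by (intro arg_cong2[where f = "(+)"] refl sum.cong) (auto simp: IH)
  also have "\<dots> = f x + (if x = y then 0 else ?\<mu> x y)"
    using assms(1,2) less.prems by auto
  finally have "f x = (if x = y then 1 else 0)"
    using conv less.prems assms(1) by (auto simp: poset_moebius.simps[of P y y] split: if_splits)
  then show ?case unfolding f_def .
qed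

text \<open>Exchanging the sums leaves for each \<open>x\<close> the factor (\<zeta> * \<mu>)(x, b),
  which collapses to \<delta>. The relation between \<open>f\<close> and \<open>g\<close> is asked
  only on the interval from \<open>a\<close> to \<open>b\<close>, because the face counts to which
  it is applied start at the span of a given face.\<close>

lemma moebius_inversion:
  fixes P :: "'a::order set" and f g :: "'a \<Rightarrow> int"
  assumes "finite P" "a \<in> P" "b \<in> P" "a \<le> b"
    and g: "\<And>c. c \<in> P \<Longrightarrow> a \<le> c \<Longrightarrow> c \<le> b \<Longrightarrow> g c = (\<Sum>x\<in>{x\<in>P. a \<le> x \<and> x \<le> c}. f x)"
  shows "f b = (\<Sum>c\<in>{c\<in>P. a \<le> c \<and> c \<le> b}. g c * poset_moebius P c b)"
proof -
  let ?I = "\<lambda>a b. {z\<in>P. a \<le> z \<and> z \<le> b}"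
  have fin: "finite (?I a b)" for a b using assms(1) by simp
  have "(\<Sum>c\<in>?I a b. g c * poset_moebius P c b)
      = (\<Sum>c\<in>?I a b. \<Sum>x\<in>{x\<in>?I a b. x \<le> c}. f x * poset_moebius P c b)"
    unfolding sum_distrib_right[symmetric]
    by (intro sum.cong refl arg_cong2[where f = "(*)"])
       (auto simp: g intro!: sum.cong intro: order_trans)
  also have "\<dots> = (\<Sum>x\<in>?I a b. \<Sum>c\<in>{c\<in>?I a b. x \<le> c}. f x * poset_moebius P c b)"
    by (rule sum.swap_restrict[OF fin fin])
  also have "\<dots> = (\<Sum>x\<in>?I a b. f x * (\<Sum>c\<in>?I x b. poset_moebius P c b))"
    unfolding sum_distrib_left by (intro sum.cong refl) (auto intro: order_trans)
  also have "\<dots> = (\<Sum>x\<in>?I a b. if x = b then f b else 0)"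
    using assms by (intro sum.cong refl) (simp add: sum_moebius_lower)
  also have "\<dots> = f b" using assms fin by simp
  finally show ?thesis by simp
qed

text \<open>Weisner's theorem, in the form dual to the usual one.\<close>

lemma sum_moebius_inf_eq_0:
  fixes P :: "'a::semilattice_inf set"
  assumes "finite P" and inf: "\<And>x y. x \<in> P \<Longrightarrow> y \<in> P \<Longrightarrow> inf x y \<in> P"
    and "h \<in> P" "b \<in> P" "h < b" "a \<in> P" "a \<le> h"
  shows "(\<Sum>x\<in>{x\<in>P. x \<le> b \<and> inf x h = a}. poset_moebius P x b) = 0"
  using assms(6,7)
proof (induction "card {z\<in>P. a < z}" arbitrary: a rule: less_induct)
  case less
  let ?S = "\<lambda>y. \<Sum>x\<in>{x\<in>P. x \<le> b \<and> inf x h = y}. poset_moebius P x b"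
  let ?J = "{y\<in>P. a \<le> y \<and> y \<le> h}"
  \<comment> \<open>The interval sum is 0 because a \<le> h < b keeps \<open>a\<close> and
    \<open>b\<close> apart. Its terms are then sorted by the meet of \<open>x\<close> with
    \<open>h\<close>; the classes of meets above \<open>a\<close> vanish by induction, which
    isolates the class of \<open>a\<close>.\<close>
  have "0 = (\<Sum>x\<in>{x\<in>P. a \<le> x \<and> x \<le> b}. poset_moebius P x b)"
    using assms less.prems by (subst sum_moebius_lower) auto
  also have "\<dots> = (\<Sum>y\<in>?J. \<Sum>x\<in>{x\<in>{x\<in>P. a \<le> x \<and> x \<le> b}. inf x h = y}. poset_moebius P x b)"
    using assms less.prems by (intro sum.group[symmetric]) auto
  also have "\<dots> = (\<Sum>y\<in>?J. ?S y)"
    by (intro sum.cong refl) (auto intro: order_trans)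
  also have "?J = insert a {y\<in>P. a < y \<and> y \<le> h}"
    using less.prems by (auto simp: le_less)
  also have "sum ?S \<dots> = ?S a + (\<Sum>y\<in>{y\<in>P. a < y \<and> y \<le> h}. ?S y)"
    using assms(1) by simp
  also have "(\<Sum>y\<in>{y\<in>P. a < y \<and> y \<le> h}. ?S y) = 0"
  proof (rule sum.neutral, rule ballI)
    fix y assume y: "y \<in> {y\<in>P. a < y \<and> y \<le> h}"
    have "{z \<in> P. y < z} \<subset> {z \<in> P. a < z}" using y by (auto intro: less_trans)
    then have "card {z \<in> P. y < z} < card {z \<in> P. a < z}"
      using assms(1) by (intro psubset_card_mono) auto
    then show "?S y = 0" using y by (intro less.hyps) auto
  qed
  finally show ?case by simp
qed

section \<open>Real arrangements\<close>

instance sign :: finite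
proof
  have "UNIV \<subseteq> {Zero, Pos, Neg}" using sign.exhaust by blast
  then show "finite (UNIV :: sign set)" by (rule finite_subset) simp
qed

lemma sign_of_eq [simp]:
  "sign_of r = Zero \<longleftrightarrow> r = 0" "sign_of r = Pos \<longleftrightarrow> r > 0" "sign_of r = Neg \<longleftrightarrow> r < 0"
  by (auto simp: sign_of_def)

lemma sign_of_eq_iff: "sign_of r = sign_of s \<longleftrightarrow> (r = 0 \<longleftrightarrow> s = 0) \<and> (r > 0 \<longleftrightarrow> s > 0)"
  by (auto simp: sign_of_def)

lemma face_comp_eq_Zero [simp]: "(X \<circ>\<^sub>F Y) k = Zero \<longleftrightarrow> X k = Zero \<and> Y k = Zero"
  by (simp add: face_comp_def)

lemma face_comp_assoc: "X \<circ>\<^sub>F Y \<circ>\<^sub>F Z = X \<circ>\<^sub>F (Y \<circ>\<^sub>F Z)"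
  by (auto simp: face_comp_def)

lemma face_le_comp: "X \<le> X \<circ>\<^sub>F Y"
  by (auto simp: face_comp_def le_fun_def less_eq_sign_def)

lemma face_le_iff_comp: "X \<le> Y \<longleftrightarrow> X \<circ>\<^sub>F Y = Y"
  by (auto simp: face_comp_def le_fun_def less_eq_sign_def fun_eq_iff)

lemma sum_by_fibre:
  fixes f :: "'a \<Rightarrow> 'b::comm_monoid_add"
  assumes "finite A" "finite B" "\<And>x. x \<in> A \<Longrightarrow> g x \<in> B"
  shows "sum f A = (\<Sum>y\<in>B. \<Sum>x\<in>{x\<in>A. g x = y}. f x)"
  using assms by (intro sum.group[symmetric]) auto

lemma dim_Int_kernel:
  fixes W :: "'a::euclidean_space set"
  assumes "linear f" "subspace W" "v \<in> W" "f v \<noteq> (0::real)"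
  shows "dim W = Suc (dim (W \<inter> {x. f x = 0}))"
proof -
  interpret f: linear f by fact
  let ?U = "W \<inter> {x. f x = 0}"
  have U: "subspace ?U"
    using assms(2) by (auto simp: subspace_def f.add f.scale f.zero)
  have "v \<notin> span ?U" using assms U by (simp add: span_eq_iff[THEN iffD2])
  moreover have "span (insert v ?U) = W"
  proof
    show "span (insert v ?U) \<subseteq> W" using assms by (intro span_minimal) auto
    show "W \<subseteq> span (insert v ?U)"
    proof
      fix u assume u: "u \<in> W"
      have "u - (f u / f v) *\<^sub>R v \<in> ?U"
        using assms u by (auto simp: f.diff f.scale intro!: subspace_diff subspace_scale)
      then show "u \<in> span (insert v ?U)"
        unfolding span_insert by (auto intro: span_base)
    qed
  qed
  ultimately show ?thesis
    using dim_insert[of v ?U] by (metis dim_span Suc_eq_plus1)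
qed

locale real_arrangement =
  fixes l :: "'t::finite \<Rightarrow> real^'d \<Rightarrow> real"
  assumes linear_form: "linear (l k)"
begin

lemma form_simps [simp]:
  "l k (x + y) = l k x + l k y" "l k (c *\<^sub>R x) = c * l k x" "l k 0 = 0" "l k (x - y) = l k x - l k y"
  using linear_form[of k] by (simp_all add: linear_add linear_scale linear_0 linear_diff)

lemma sign_perturb:
  obtains e where "e > 0"
    and "\<And>t k. \<bar>t\<bar> \<le> e \<Longrightarrow> l k x \<noteq> 0 \<Longrightarrow> sign_of (l k (x + t *\<^sub>R y)) = sign_of (l k x)"
proof -
  \<comment> \<open>The sign at \<open>x\<close> survives as long as the change
    \<open>t * l k y\<close> is smaller than \<open>l k x\<close> in absolute value. The added 1
    keeps the denominator positive and the inequality strict; forms vanishing at \<open>x\<close>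
    impose no bound, and 1 stands in for them.\<close>
  let ?e = "\<lambda>k. if l k x = 0 then 1 else \<bar>l k x\<bar> / (\<bar>l k y\<bar> + 1)"
  define e where "e = Min (range ?e)"
  have pos: "0 < ?e k" for k by (simp add: add_nonneg_pos)
  have "0 < e" unfolding e_def using pos by (subst Min_gr_iff) auto
  moreover have "sign_of (l k (x + t *\<^sub>R y)) = sign_of (l k x)" if t: "\<bar>t\<bar> \<le> e" and k: "l k x \<noteq> 0" for t k
  proof -
    have "e \<le> ?e k" unfolding e_def by (intro Min_le) auto
    then have "\<bar>t\<bar> \<le> \<bar>l k x\<bar> / (\<bar>l k y\<bar> + 1)" using t k by auto
    then have "\<bar>t\<bar> * (\<bar>l k y\<bar> + 1) \<le> \<bar>l k x\<bar>"
      by (simp add: field_simps)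
    moreover have "\<bar>t * l k y\<bar> < \<bar>t\<bar> * (\<bar>l k y\<bar> + 1) \<or> t = 0"
      by (auto simp: abs_mult algebra_simps)
    ultimately have "\<bar>t * l k y\<bar> < \<bar>l k x\<bar>" using k by auto
    then show ?thesis by (auto simp: sign_of_eq_iff)
  qed
  ultimately show ?thesis by (rule that)
qed

text \<open>The geometric meaning of composition: a short move from \<open>x\<close> in the
  direction \<open>y\<close> keeps the nonzero signs of \<open>x\<close>, and a form vanishing at
  \<open>x\<close> takes its sign from \<open>y\<close>.\<close>

lemma sign_vector_comp:
  obtains e where "e > 0" "sign_vector l (x + e *\<^sub>R y) = sign_vector l x \<circ>\<^sub>F sign_vector l y"
proof -
  obtain e where e: "e > 0"
    "\<And>t k. \<bar>t\<bar> \<le> e \<Longrightarrow> l k x \<noteq> 0 \<Longrightarrow> sign_of (l k (x + t *\<^sub>R y)) = sign_of (l k x)"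
    using sign_perturb[of x y] by metis
  have "sign_vector l (x + e *\<^sub>R y) = sign_vector l x \<circ>\<^sub>F sign_vector l y"
  proof
    fix k
    show "sign_vector l (x + e *\<^sub>R y) k = (sign_vector l x \<circ>\<^sub>F sign_vector l y) k"
      using e(1) e(2)[of e k]
      by (cases "l k x = 0") (auto simp: sign_vector_def face_comp_def sign_of_eq_iff zero_less_mult_iff)
  qed
  with e(1) show ?thesis by (rule that)
qed

lemma faces_comp: "X \<in> faces l \<Longrightarrow> Y \<in> faces l \<Longrightarrow> X \<circ>\<^sub>F Y \<in> faces l"
proof -
  assume "X \<in> faces l" "Y \<in> faces l"
  then obtain x y where "X = sign_vector l x" "Y = sign_vector l y" by (auto simp: faces_def)
  then obtain e where "sign_vector l (x + e *\<^sub>R y) = X \<circ>\<^sub>F Y"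
    using sign_vector_comp by metis
  then show "X \<circ>\<^sub>F Y \<in> faces l" unfolding faces_def by (metis rangeI)
qed

text \<open>The cone of \<open>X\<close> is open in the flat on the right: a short move from
  \<open>x\<close> along a direction \<open>v\<close> of the flat stays in the cone, and the
  difference of the two points is a multiple of \<open>v\<close>. From here on spans are handled by
  equations.\<close>

lemma face_span_eq:
  assumes "X \<in> faces l"
  shows "face_span l X = {v. \<forall>k. X k = Zero \<longrightarrow> l k v = 0}" (is "_ = ?F")
proof
  show "face_span l X \<subseteq> ?F" unfolding face_span_def
    by (rule span_minimal) (auto simp: sign_vector_def subspace_def)
  obtain x where x: "X = sign_vector l x" using assms by (auto simp: faces_def)
  show "?F \<subseteq> face_span l X"
  proof
    fix v assume v: "v \<in> ?F"
    obtain e where e: "e > 0" "sign_vector l (x + e *\<^sub>R v) = X \<circ>\<^sub>F sign_vector l v"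
      using sign_vector_comp x by metis
    have "X \<circ>\<^sub>F sign_vector l v = X"
      using v by (auto simp: fun_eq_iff face_comp_def sign_vector_def)
    then have "x + e *\<^sub>R v \<in> face_span l X" "x \<in> face_span l X"
      unfolding face_span_def using e x by (auto intro: span_base)
    then have "(1 / e) *\<^sub>R ((x + e *\<^sub>R v) - x) \<in> face_span l X"
      unfolding face_span_def by (intro span_scale span_diff)
    then show "v \<in> face_span l X" using e by simp
  qed
qed

lemma flats_iff: "\<beta> \<in> flats l \<longleftrightarrow> (\<exists>S. \<beta> = {v. \<forall>k\<in>S. l k v = 0})"
  unfolding flats_def zero_set_def by auto

lemma finite_flats: "finite (flats l)"
  unfolding flats_def by simp

lemma flats_Int: "\<alpha> \<in> flats l \<Longrightarrow> \<beta> \<in> flats l \<Longrightarrow> \<alpha> \<inter> \<beta> \<in> flats l"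
proof -
  assume "\<alpha> \<in> flats l" "\<beta> \<in> flats l"
  then obtain S T where "\<alpha> = {v. \<forall>k\<in>S. l k v = 0}" "\<beta> = {v. \<forall>k\<in>T. l k v = 0}"
    by (auto simp: flats_iff)
  then show "\<alpha> \<inter> \<beta> \<in> flats l" unfolding flats_iff by (intro exI[of _ "S \<union> T"]) auto
qed

lemma UNIV_flat: "UNIV \<in> flats l"
  unfolding flats_iff by (intro exI[of _ "{}"]) auto

lemma subspace_flat: "\<beta> \<in> flats l \<Longrightarrow> subspace \<beta>"
  unfolding flats_iff subspace_def by auto

lemma face_span_flat: "X \<in> faces l \<Longrightarrow> face_span l X \<in> flats l"
  unfolding flats_iff by (intro exI[of _ "{k. X k = Zero}"]) (simp add: face_span_eq)

lemma face_span_subset_iff: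
  assumes "\<beta> = {v. \<forall>k\<in>S. l k v = 0}" "X \<in> faces l"
  shows "face_span l X \<subseteq> \<beta> \<longleftrightarrow> (\<forall>k\<in>S. X k = Zero)"
proof
  obtain x where x: "X = sign_vector l x" using assms by (auto simp: faces_def)
  have "x \<in> face_span l X" using assms(2) x by (simp add: face_span_eq sign_vector_def)
  then show "face_span l X \<subseteq> \<beta> \<Longrightarrow> \<forall>k\<in>S. X k = Zero"
    using assms(1) x by (auto simp: sign_vector_def)
qed (use assms in \<open>auto simp: face_span_eq\<close>)

lemma face_span_sign_vector:
  assumes "\<beta> \<in> flats l"
  shows "face_span l (sign_vector l x) \<subseteq> \<beta> \<longleftrightarrow> x \<in> \<beta>"
proof -
  obtain S where "\<beta> = {v. \<forall>k\<in>S. l k v = 0}" using assms flats_iff by auto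
  then show ?thesis
    using face_span_subset_iff[of \<beta> S "sign_vector l x"] by (auto simp: faces_def sign_vector_def)
qed

text \<open>A coordinate of a composition is \<open>Zero\<close> only if it is so in both factors,
  so the span of \<open>X \<circ>\<^sub>F Y\<close> is the join of the two spans. Phrased by upper
  bounds, this requires no construction of joins of flats.\<close>

lemma face_span_comp_subset_iff:
  assumes "\<beta> \<in> flats l" "X \<in> faces l" "Y \<in> faces l"
  shows "face_span l (X \<circ>\<^sub>F Y) \<subseteq> \<beta> \<longleftrightarrow> face_span l X \<subseteq> \<beta> \<and> face_span l Y \<subseteq> \<beta>"
proof -
  obtain S where "\<beta> = {v. \<forall>k\<in>S. l k v = 0}" using assms flats_iff by auto
  then show ?thesis
    using face_span_subset_iff[of \<beta> S] assms faces_comp by auto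
qed

text \<open>
  Rota's sign theorem, by Weisner's theorem for a hyperplane section \<open>h\<close> of \<open>\<pi>\<close>: the flats \<open>x \<noteq> \<gamma>\<close>
  with \<open>x \<inter> h = \<gamma>\<close> all have dimension \<open>dim \<gamma> + 1\<close>.
\<close>

lemma moebius_flats_sign:
  assumes "\<gamma> \<in> flats l" "\<pi> \<in> flats l" "\<gamma> \<subseteq> \<pi>"
  shows "0 < (-1) ^ (dim \<pi> + dim \<gamma>) * poset_moebius (flats l) \<gamma> \<pi>"
  using assms(1,3)
proof (induction "dim \<pi> - dim \<gamma>" arbitrary: \<gamma> rule: less_induct)
  case less
  let ?\<mu> = "poset_moebius (flats l)"
  show ?case
  proof (cases "\<gamma> = \<pi>")
    case True
    then show ?thesis using assms finite_flats by (simp add: poset_moebius.simps)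
  next
    case False
    let ?cut = "\<lambda>T. {x\<in>\<pi>. \<forall>k\<in>T. l k x = 0}"
    obtain S where S: "\<gamma> = {v. \<forall>k\<in>S. l k v = 0}" using less.prems flats_iff by auto
    obtain S' where S': "\<pi> = {v. \<forall>k\<in>S'. l k v = 0}" using assms(2) flats_iff by auto
    have "?cut S = \<gamma>" using S less.prems by auto
    \<comment> \<open>Minimality of \<open>T\<close> makes the flat \<open>x\<^sub>0\<close>, cut
      out by \<open>T\<close> without \<open>k\<close>, strictly larger than \<gamma>, while the
      hyperplane of \<open>k\<close> cuts it back to \<gamma>. Hence \<open>h\<close> is a proper
      section of \<pi>, and the set \<open>A\<close> below is nonempty, so that the sum over it is
      strictly positive.\<close>
    then obtain T where T: "?cut T = \<gamma>" and T_min: "\<And>T'. ?cut T' = \<gamma> \<Longrightarrow> card T \<le> card T'"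
      using ex_has_least_nat[of "\<lambda>T. ?cut T = \<gamma>" S card] by auto
    have "T \<noteq> {}" using T False by auto
    then obtain k where k: "k \<in> T" by auto
    define x\<^sub>0 where "x\<^sub>0 = ?cut (T - {k})"
    define h where "h = ?cut {k}"
    have cut_flat: "?cut T' \<in> flats l" for T'
      unfolding flats_iff S' by (intro exI[of _ "S' \<union> T'"]) auto
    have x\<^sub>0: "x\<^sub>0 \<in> flats l" and h: "h \<in> flats l"
      unfolding x\<^sub>0_def h_def by (rule cut_flat)+
    have x\<^sub>0h: "x\<^sub>0 \<inter> h = \<gamma>" unfolding x\<^sub>0_def h_def T[symmetric] using k by auto
    have x\<^sub>0_ne: "x\<^sub>0 \<noteq> \<gamma>"
    proof
      assume "x\<^sub>0 = \<gamma>"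
      then have "card T \<le> card (T - {k})" unfolding x\<^sub>0_def by (rule T_min)
      then show False using k by (meson card_Diff1_less finite leD)
    qed
    have x\<^sub>0_le: "x\<^sub>0 \<subseteq> \<pi>" and h_le: "h \<subseteq> \<pi>" unfolding x\<^sub>0_def h_def by auto
    have "h \<subset> \<pi>" using h_le x\<^sub>0h x\<^sub>0_ne x\<^sub>0_le by blast
    have "\<gamma> \<subseteq> h" using x\<^sub>0h by auto
    define A where "A = {x\<in>flats l. x \<subseteq> \<pi> \<and> x \<inter> h = \<gamma> \<and> x \<noteq> \<gamma>}"
    have fin: "finite A" using finite_flats by (simp add: A_def)
    have "{x\<in>flats l. x \<subseteq> \<pi> \<and> x \<inter> h = \<gamma>} = insert \<gamma> A"
      using less.prems \<open>\<gamma> \<subseteq> h\<close> by (auto simp: A_def)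
    moreover have "(\<Sum>x\<in>{x\<in>flats l. x \<subseteq> \<pi> \<and> x \<inter> h = \<gamma>}. ?\<mu> x \<pi>) = 0"
      using sum_moebius_inf_eq_0[of "flats l" h \<pi> \<gamma>] finite_flats flats_Int h assms(2)
        \<open>h \<subset> \<pi>\<close> \<open>\<gamma> \<subseteq> h\<close> less.prems by auto
    ultimately have \<mu>: "?\<mu> \<gamma> \<pi> = - (\<Sum>x\<in>A. ?\<mu> x \<pi>)" using fin by (simp add: A_def)
    have "0 < (-1) ^ (dim \<pi> + Suc (dim \<gamma>)) * ?\<mu> x \<pi>" if x: "x \<in> A" for x
    proof -
      have x': "x \<in> flats l" "x \<subseteq> \<pi>" "x \<inter> h = \<gamma>" "x \<noteq> \<gamma>" using x by (auto simp: A_def)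
      have ker: "x \<inter> {v. l k v = 0} = \<gamma>" using x' by (auto simp: h_def)
      then obtain v where "v \<in> x" "l k v \<noteq> 0" using x' by blast
      then have "dim x = Suc (dim \<gamma>)"
        using dim_Int_kernel[OF linear_form subspace_flat] x' ker by metis
      moreover have "dim x \<le> dim \<pi>" using x' by (intro dim_subset)
      ultimately show ?thesis using less.hyps[of x] x' by (auto simp: A_def)
    qed
    moreover have "A \<noteq> {}" using x\<^sub>0 x\<^sub>0_le x\<^sub>0h x\<^sub>0_ne by (auto simp: A_def)
    ultimately have "0 < (\<Sum>x\<in>A. (-1) ^ (dim \<pi> + Suc (dim \<gamma>)) * ?\<mu> x \<pi>)"
      using fin by (intro sum_pos)
    then show ?thesis unfolding \<mu> by (simp add: sum_distrib_left sum_negf)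
  qed
qed

section \<open>Euler characteristic of the cells of a subspace\<close>

definition cell :: "'t set \<Rightarrow> real^'d \<Rightarrow> 't face" where
  "cell K x = (\<lambda>k. if k \<in> K then sign_of (l k x) else Zero)"

text \<open>For a cell that occurs in \<open>V\<close> these equations cut out its linear span, so
  \<open>dim\<close> of this set is the dimension of the cell. Cells of \<open>K\<close> carry
  \<open>Zero\<close> outside \<open>K\<close>, so that adding a form changes a single
  coordinate.\<close>

definition cell_span :: "'t set \<Rightarrow> (real^'d) set \<Rightarrow> 't face \<Rightarrow> (real^'d) set" where
  "cell_span K V \<sigma> = {x\<in>V. \<forall>k\<in>K. \<sigma> k = Zero \<longrightarrow> l k x = 0}"

text \<open>
  A new hyperplane either leaves a cell of dimension \<open>d\<close> whole or cuts it into cells of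
  dimensions \<open>d\<close>, \<open>d\<close> and \<open>d - 1\<close>; both leave the alternating sum unchanged.
\<close>

lemma sum_cut_cell:
  assumes V: "subspace V" and \<sigma>: "\<sigma> \<in> cell K ` V" and k: "k \<notin> K"
  defines "W \<equiv> cell_span K V \<sigma>"
  shows "(\<Sum>s\<in>(\<lambda>x. sign_of (l k x)) ` {x\<in>V. cell K x = \<sigma>}.
            (-1) ^ dim (if s = Zero then W \<inter> {x. l k x = 0} else W)) = (-1 :: int) ^ dim W"
proof -
  let ?C = "{x\<in>V. cell K x = \<sigma>}"
  let ?s = "\<lambda>x. sign_of (l k x)"
  obtain x where x: "x \<in> ?C" using \<sigma> by auto
  have W: "subspace W" unfolding W_def cell_span_def
    using V by (auto simp: subspace_def)
  have CW: "?C \<subseteq> W" by (auto simp: W_def cell_span_def cell_def)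
  \<comment> \<open>Moving both ways is what places points of the cell on either side of a
    hyperplane that meets it.\<close>
  have perturb: "\<exists>e>0. x + e *\<^sub>R v \<in> ?C \<and> x - e *\<^sub>R v \<in> ?C" if x: "x \<in> ?C" and v: "v \<in> W" for x v
  proof -
    obtain e where e: "e > 0"
      "\<And>t k. \<bar>t\<bar> \<le> e \<Longrightarrow> l k x \<noteq> 0 \<Longrightarrow> sign_of (l k (x + t *\<^sub>R v)) = sign_of (l k x)"
      using sign_perturb[of x v] by metis
    have "x + t *\<^sub>R v \<in> ?C" if "\<bar>t\<bar> \<le> e" for t
    proof -
      have "cell K (x + t *\<^sub>R v) k = cell K x k" for k
        using e(2)[OF that, of k] x v
        by (cases "l k x = 0") (auto simp: cell_def W_def cell_span_def)
      moreover have "x + t *\<^sub>R v \<in> V"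
        using x v V by (auto simp: W_def cell_span_def intro!: subspace_add subspace_scale)
      ultimately show ?thesis using x by auto
    qed
    from this[of e] this[of "-e"] show ?thesis using e(1) by (intro exI[of _ e]) auto
  qed
  show ?thesis
  proof (cases "\<forall>v\<in>W. l k v = 0")
    case True
    then have "?s y = Zero" if "y \<in> ?C" for y using that CW by auto
    then have "?s ` ?C = (\<lambda>_. Zero) ` ?C" by (rule image_cong[OF refl])
    also have "\<dots> = {Zero}" by (rule image_constant[OF x])
    finally have "?s ` ?C = {Zero}" .
    moreover have "W \<inter> {x. l k x = 0} = W" using True by auto
    ultimately show ?thesis by simp
  next
    case False
    then obtain v where v: "v \<in> W" "l k v \<noteq> 0" by auto
    define u where "u = (1 / l k v) *\<^sub>R v"
    have u: "u \<in> W" "l k u = 1" using v W by (auto simp: u_def subspace_scale)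
    have d: "dim W = Suc (dim (W \<inter> {x. l k x = 0}))"
      using dim_Int_kernel[OF linear_form W] v by metis
    show ?thesis
    proof (cases "\<exists>x\<in>?C. l k x = 0")
      case True
      then obtain x where x: "x \<in> ?C" "l k x = 0" by auto
      obtain e where e: "e > 0" "x + e *\<^sub>R u \<in> ?C" "x - e *\<^sub>R u \<in> ?C"
        using perturb[OF x(1) u(1)] by (elim exE conjE) (rule that)
      \<comment> \<open>With d the dimension of \<open>W\<close>, the three pieces contribute (-1)^d
        + (-1)^d + (-1)^(d-1), which is (-1)^d.\<close>
      define T where "T = ?s ` ?C"
      have "Zero \<in> T" unfolding T_def using x by (intro image_eqI[OF _ x(1)]) (auto simp: sign_of_def)
      moreover have "Pos \<in> T" unfolding T_def using x(2) u e(1) by (intro image_eqI[OF _ e(2)]) (auto simp: sign_of_def)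
      moreover have "Neg \<in> T" unfolding T_def using x(2) u e(1) by (intro image_eqI[OF _ e(3)]) (auto simp: sign_of_def)
      ultimately have "T = {Zero, Pos, Neg}" using sign.exhaust by blast
      then have "?s ` ?C = {Zero, Pos, Neg}" unfolding T_def .
      then show ?thesis using d by simp
    next
      case no0: False
      have same: "?s y = ?s x" if y: "y \<in> ?C" for y
      proof (rule ccontr)
        assume ne: "?s y \<noteq> ?s x"
        have nz: "l k x \<noteq> 0" "l k y \<noteq> 0" using no0 x y by auto
        \<comment> \<open>The positive coefficients make the opposite values of the form at
          \<open>x\<close> and \<open>y\<close> cancel, and \<open>z\<close> stays in the cell
          because the cell is a convex cone.\<close>
        define z where "z = \<bar>l k y\<bar> *\<^sub>R x + \<bar>l k x\<bar> *\<^sub>R y"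
        have "l k z = 0" using ne nz by (auto simp: z_def sign_of_eq_iff abs_if)
        moreover have "z \<in> V" using x y V by (auto simp: z_def intro!: subspace_add subspace_scale)
        moreover have "cell K z = \<sigma>"
        proof
          fix j
          have "cell K x j = \<sigma> j" "cell K y j = \<sigma> j" using x y by auto
          then show "cell K z j = \<sigma> j" using nz
            by (cases "\<sigma> j") (auto simp: cell_def z_def add_pos_pos add_neg_neg mult_pos_neg split: if_splits)
        qed
        ultimately show False using no0 by auto
      qed
      have "?s ` ?C = (\<lambda>_. ?s x) ` ?C" by (rule image_cong[OF refl same])
      also have "\<dots> = {?s x}" by (rule image_constant[OF x])
      finally have "?s ` ?C = {?s x}" .
      moreover have "l k x \<noteq> 0" using no0 x by blast
      ultimately show ?thesis by simp
    qed
  qed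
qed

text \<open>Resetting the coordinate \<open>k\<close> to \<open>Zero\<close> groups the new cells
  over the old ones, and \<open>sum_cut_cell\<close> evaluates each group to the term of the old
  cell. Without forms the only cell is \<open>V\<close> itself.\<close>

lemma sum_cells:
  assumes V: "subspace V"
  shows "(\<Sum>\<sigma>\<in>cell K ` V. (-1) ^ dim (cell_span K V \<sigma>)) = (-1 :: int) ^ dim V"
  using finite[of K]
proof (induction K rule: finite_induct)
  case empty
  have "cell {} ` V = {\<lambda>k. Zero}" using subspace_0[OF V] by (auto simp: cell_def)
  then show ?case by (simp add: cell_span_def)
next
  case (insert k K)
  let ?C = "cell (insert k K) ` V"
  let ?S = "\<lambda>\<sigma>. (\<lambda>x. sign_of (l k x)) ` {x\<in>V. cell K x = \<sigma>}"
  let ?f = "\<lambda>\<sigma>. (-1 :: int) ^ dim (cell_span (insert k K) V \<sigma>)"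
  have restrict: "(cell (insert k K) x)(k := Zero) = cell K x" for x
    using insert.hyps by (auto simp: cell_def)
  have extend: "cell (insert k K) x = (cell K x)(k := sign_of (l k x))" for x
    by (auto simp: cell_def)
  have "sum ?f ?C = (\<Sum>\<sigma>\<in>cell K ` V. \<Sum>\<sigma>'\<in>{\<sigma>'\<in>?C. \<sigma>'(k := Zero) = \<sigma>}. ?f \<sigma>')"
    by (rule sum_by_fibre) (auto simp: restrict)
  also have "\<dots> = (\<Sum>\<sigma>\<in>cell K ` V. (-1) ^ dim (cell_span K V \<sigma>))"
  proof (rule sum.cong[OF refl])
    fix \<sigma> assume \<sigma>: "\<sigma> \<in> cell K ` V"
    let ?W = "cell_span K V \<sigma>"
    have "{\<sigma>'\<in>?C. \<sigma>'(k := Zero) = \<sigma>} = (\<lambda>s. \<sigma>(k := s)) ` ?S \<sigma>"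
    proof (intro subset_antisym subsetI)
      fix \<sigma>' assume "\<sigma>' \<in> {\<sigma>'\<in>?C. \<sigma>'(k := Zero) = \<sigma>}"
      then obtain x where "x \<in> V" "\<sigma>' = cell (insert k K) x" "cell K x = \<sigma>"
        using restrict by auto
      then show "\<sigma>' \<in> (\<lambda>s. \<sigma>(k := s)) ` ?S \<sigma>" using extend by auto
    next
      fix \<sigma>' assume "\<sigma>' \<in> (\<lambda>s. \<sigma>(k := s)) ` ?S \<sigma>"
      then obtain x where "x \<in> V" "\<sigma>' = cell (insert k K) x" "cell K x = \<sigma>"
        using extend by auto
      then show "\<sigma>' \<in> {\<sigma>'\<in>?C. \<sigma>'(k := Zero) = \<sigma>}" using restrict by auto
    qed
    moreover have "inj_on (\<lambda>s. \<sigma>(k := s)) (?S \<sigma>)"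
      by (auto simp: inj_on_def fun_upd_eqD)
    ultimately have "(\<Sum>\<sigma>'\<in>{\<sigma>'\<in>?C. \<sigma>'(k := Zero) = \<sigma>}. ?f \<sigma>') = (\<Sum>s\<in>?S \<sigma>. ?f (\<sigma>(k := s)))"
      by (simp add: sum.reindex)
    also have "\<dots> = (\<Sum>s\<in>?S \<sigma>. (-1) ^ dim (if s = Zero then ?W \<inter> {x. l k x = 0} else ?W))"
      using insert.hyps
      by (intro sum.cong refl arg_cong[where f = "\<lambda>A. (-1) ^ dim A"]) (auto simp: cell_span_def)
    also have "\<dots> = (-1) ^ dim ?W"
      by (rule sum_cut_cell[OF V \<sigma> insert.hyps(2)])
    finally show "(\<Sum>\<sigma>'\<in>{\<sigma>'\<in>?C. \<sigma>'(k := Zero) = \<sigma>}. ?f \<sigma>') = (-1) ^ dim ?W" .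
  qed
  also have "\<dots> = (-1) ^ dim V" by (rule insert.IH)
  finally show ?case .
qed

text \<open>Near \<open>Y\<close> only the forms vanishing on \<open>Y\<close> matter: a face above
  \<open>Y\<close> is determined by its signs on \<open>K\<close>, and the signs on \<open>K\<close>
  of a point of \<pi> are attained above \<open>Y\<close> by composing \<open>Y\<close> with the
  face of that point. This identifies the faces in question with cells.\<close>

lemma sum_faces_above:
  assumes Y: "Y \<in> faces l" and \<pi>: "\<pi> \<in> flats l" and Y\<pi>: "face_span l Y \<subseteq> \<pi>"
  shows "(\<Sum>R\<in>{R\<in>faces l. Y \<le> R \<and> face_span l R \<subseteq> \<pi>}. (-1) ^ dim (face_span l R)) = (-1 :: int) ^ dim \<pi>"
proof -
  let ?A = "{R\<in>faces l. Y \<le> R \<and> face_span l R \<subseteq> \<pi>}"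
  define K where "K = {k. Y k = Zero}"
  define r where "r R = (\<lambda>k. if k \<in> K then R k else Zero)" for R :: "'t face"
  have inj: "inj_on r ?A"
  proof (rule inj_onI)
    fix R R' assume R: "R \<in> ?A" "R' \<in> ?A" and eq: "r R = r R'"
    show "R = R'"
    proof
      fix k
      show "R k = R' k"
        using fun_cong[OF eq, of k] R
        by (cases "Y k = Zero") (auto simp: r_def K_def le_fun_def less_eq_sign_def dest!: spec[of _ k])
    qed
  qed
  have img: "r ` ?A = cell K ` \<pi>"
  proof (intro subset_antisym subsetI)
    fix \<sigma> assume "\<sigma> \<in> r ` ?A"
    then obtain R where R: "R \<in> ?A" "\<sigma> = r R" by auto
    then obtain x where x: "R = sign_vector l x" by (auto simp: faces_def)
    have "x \<in> \<pi>" using R x face_span_sign_vector[OF \<pi>] by auto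
    moreover have "\<sigma> = cell K x" using R x by (auto simp: r_def cell_def sign_vector_def)
    ultimately show "\<sigma> \<in> cell K ` \<pi>" by auto
  next
    fix \<sigma> assume "\<sigma> \<in> cell K ` \<pi>"
    then obtain x where x: "x \<in> \<pi>" "\<sigma> = cell K x" by auto
    have sx: "sign_vector l x \<in> faces l" by (simp add: faces_def)
    have A: "Y \<circ>\<^sub>F sign_vector l x \<in> ?A"
      using faces_comp[OF Y sx] face_span_comp_subset_iff[OF \<pi> Y sx] Y\<pi> face_le_comp
        face_span_sign_vector[OF \<pi>] x by auto
    have "\<sigma> = r (Y \<circ>\<^sub>F sign_vector l x)"
      using x by (auto simp: r_def cell_def face_comp_def sign_vector_def K_def)
    then show "\<sigma> \<in> r ` ?A" using A by (rule image_eqI)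
  qed
  have "(\<Sum>R\<in>?A. (-1 :: int) ^ dim (cell_span K \<pi> (r R)))
      = (\<Sum>\<sigma>\<in>cell K ` \<pi>. (-1) ^ dim (cell_span K \<pi> \<sigma>))"
    unfolding img[symmetric] by (simp only: sum.reindex[OF inj] o_def)
  also have "\<dots> = (-1) ^ dim \<pi>"
    by (rule sum_cells[OF subspace_flat[OF \<pi>]])
  finally have "(\<Sum>R\<in>?A. (-1 :: int) ^ dim (cell_span K \<pi> (r R))) = (-1) ^ dim \<pi>" .
  moreover have "cell_span K \<pi> (r R) = face_span l R" if R: "R \<in> ?A" for R
  proof -
    have "k \<in> K" if "R k = Zero" for k
      using R that by (auto simp: K_def le_fun_def less_eq_sign_def dest: spec[of _ k])
    moreover have "face_span l R = {v. \<forall>k. R k = Zero \<longrightarrow> l k v = 0}" using R by (simp add: face_span_eq)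
    ultimately show ?thesis using R by (auto simp: cell_span_def r_def)
  qed
  ultimately show ?thesis by simp
qed

text \<open>The local version of Zaslavsky's count of the chambers.\<close>

lemma card_faces_above:
  assumes Y: "Y \<in> faces l" and \<pi>: "\<pi> \<in> flats l" and Y\<pi>: "face_span l Y \<subseteq> \<pi>"
  shows "int (card {R\<in>faces l. Y \<le> R \<and> face_span l R = \<pi>})
     = (\<Sum>\<gamma>\<in>{\<gamma>\<in>flats l. face_span l Y \<subseteq> \<gamma> \<and> \<gamma> \<subseteq> \<pi>}. \<bar>poset_moebius (flats l) \<gamma> \<pi>\<bar>)"
proof -
  let ?N = "\<lambda>\<gamma>. {R\<in>faces l. Y \<le> R \<and> face_span l R = \<gamma>}"
  let ?\<mu> = "poset_moebius (flats l)"
  let ?I = "\<lambda>\<gamma>. {\<delta>\<in>flats l. face_span l Y \<subseteq> \<delta> \<and> \<delta> \<subseteq> \<gamma>}"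
  have mono: "face_span l Y \<subseteq> face_span l R" if "R \<in> faces l" "Y \<le> R" for R
    using that Y by (auto simp: face_span_eq le_fun_def less_eq_sign_def)
  \<comment> \<open>Sorting the faces by their span turns the alternating sums into sums over flats;
    inversion then isolates the faces that span \<pi>.\<close>
  have "(-1) ^ dim \<pi> * int (card (?N \<pi>)) = (\<Sum>\<gamma>\<in>?I \<pi>. (-1) ^ dim \<gamma> * ?\<mu> \<gamma> \<pi>)"
  proof (rule moebius_inversion[OF finite_flats face_span_flat[OF Y] \<pi> Y\<pi>])
    fix \<gamma> assume \<gamma>: "\<gamma> \<in> flats l" "face_span l Y \<subseteq> \<gamma>"
    let ?A = "{R\<in>faces l. Y \<le> R \<and> face_span l R \<subseteq> \<gamma>}"
    have "(-1) ^ dim \<gamma> = (\<Sum>R\<in>?A. (-1 :: int) ^ dim (face_span l R))"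
      by (rule sum_faces_above[OF Y \<gamma>, symmetric])
    also have "\<dots> = (\<Sum>\<delta>\<in>?I \<gamma>. \<Sum>R\<in>{R\<in>?A. face_span l R = \<delta>}. (-1) ^ dim (face_span l R))"
      using finite_flats face_span_flat mono by (intro sum_by_fibre) auto
    also have "\<dots> = (\<Sum>\<delta>\<in>?I \<gamma>. (-1) ^ dim \<delta> * int (card (?N \<delta>)))"
    proof (rule sum.cong[OF refl])
      fix \<delta> assume "\<delta> \<in> ?I \<gamma>"
      then have "{R\<in>?A. face_span l R = \<delta>} = ?N \<delta>" by auto
      then show "(\<Sum>R\<in>{R\<in>?A. face_span l R = \<delta>}. (-1) ^ dim (face_span l R))
          = (-1) ^ dim \<delta> * int (card (?N \<delta>))" by simp
    qed
    finally show "(-1) ^ dim \<gamma> = (\<Sum>\<delta>\<in>?I \<gamma>. (-1) ^ dim \<delta> * int (card (?N \<delta>)))" .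
  qed
  then have "(-1) ^ dim \<pi> * ((-1) ^ dim \<pi> * int (card (?N \<pi>)))
      = (\<Sum>\<gamma>\<in>?I \<pi>. (-1) ^ (dim \<pi> + dim \<gamma>) * ?\<mu> \<gamma> \<pi>)"
    by (simp add: sum_distrib_left power_add mult.assoc)
  also have "\<dots> = (\<Sum>\<gamma>\<in>?I \<pi>. \<bar>?\<mu> \<gamma> \<pi>\<bar>)"
  proof (rule sum.cong[OF refl])
    fix \<gamma> assume "\<gamma> \<in> ?I \<pi>"
    then have "0 < (-1) ^ (dim \<pi> + dim \<gamma>) * ?\<mu> \<gamma> \<pi>"
      using moebius_flats_sign \<pi> by auto
    then have "(-1) ^ (dim \<pi> + dim \<gamma>) * ?\<mu> \<gamma> \<pi> = \<bar>(-1) ^ (dim \<pi> + dim \<gamma>) * ?\<mu> \<gamma> \<pi>\<bar>" by simp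
    then show "(-1) ^ (dim \<pi> + dim \<gamma>) * ?\<mu> \<gamma> \<pi> = \<bar>?\<mu> \<gamma> \<pi>\<bar>"
      by (simp add: abs_mult power_abs)
  qed
  finally show ?thesis by (simp add: mult.assoc[symmetric] power_add[symmetric])
qed

end

section \<open>Diagonalizability and traces\<close>

text \<open>The product of the factors A - e applied to \<open>v\<close>, written as an iterated
  action on vectors so that it matches the same iteration on functions in the band walk. It is used
  over the reals and over the complex numbers.\<close>

definition shifts :: "'a::field mat \<Rightarrow> 'a list \<Rightarrow> 'a Matrix.vec \<Rightarrow> 'a Matrix.vec" where
  "shifts A es v = foldl (\<lambda>u e. A *\<^sub>v u - e \<cdot>\<^sub>v u) v es"

lemma shifts_simps [simp]:
  "shifts A [] v = v" "shifts A (e # es) v = shifts A es (A *\<^sub>v v - e \<cdot>\<^sub>v v)"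
  by (simp_all add: shifts_def)

lemma shifts_eigenvector:
  assumes A: "A \<in> carrier_mat n n" and "v \<in> carrier_vec n" "A *\<^sub>v v = a \<cdot>\<^sub>v v"
  shows "shifts A es v = (\<Prod>e\<leftarrow>es. a - e) \<cdot>\<^sub>v v"
  using assms(2,3)
proof (induction es arbitrary: v)
  case Nil
  then show ?case by simp
next
  case (Cons e es)
  have eq: "A *\<^sub>v v - e \<cdot>\<^sub>v v = (a - e) \<cdot>\<^sub>v v"
    using Cons.prems by (auto simp: left_diff_distrib intro!: eq_vecI)
  have "A *\<^sub>v ((a - e) \<cdot>\<^sub>v v) = a \<cdot>\<^sub>v ((a - e) \<cdot>\<^sub>v v)"
    using Cons.prems A by (simp add: mult_mat_vec smult_smult_assoc mult.commute)
  then have "shifts A es ((a - e) \<cdot>\<^sub>v v) = (\<Prod>e\<leftarrow>es. a - e) \<cdot>\<^sub>v ((a - e) \<cdot>\<^sub>v v)"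
    using Cons.prems by (intro Cons.IH) auto
  then show ?case by (simp add: eq smult_smult_assoc mult.commute)
qed

lemma shifts_commute:
  assumes A: "A \<in> carrier_mat n n" and "v \<in> carrier_vec n"
  shows "shifts A es (A *\<^sub>v v - a \<cdot>\<^sub>v v) = A *\<^sub>v shifts A es v - a \<cdot>\<^sub>v shifts A es v"
  using assms(2)
proof (induction es arbitrary: v)
  case Nil
  then show ?case by simp
next
  case (Cons e es)
  let ?f = "\<lambda>e u. A *\<^sub>v u - e \<cdot>\<^sub>v u"
  have Av: "A *\<^sub>v u \<in> carrier_vec n" if "u \<in> carrier_vec n" for u using A that by simp
  have "?f e (?f a v) = ?f a (?f e v)"
    using Cons.prems A Av
    by (auto simp: mult_minus_distrib_mat_vec[of _ n n] mult_mat_vec[of _ n n] algebra_simps intro!: eq_vecI)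
  then show ?case using Cons.IH[of "?f e v"] Cons.prems Av by simp
qed

lemma prod_list_diff_eq_0_iff: "(\<Prod>e\<leftarrow>es. (a::'a::field) - e) = 0 \<longleftrightarrow> a \<in> set es"
  by (induction es) auto

lemma char_matrix_mult_vec:
  assumes "A \<in> carrier_mat n n" "v \<in> carrier_vec n"
  shows "char_matrix A e *\<^sub>v v = A *\<^sub>v v - e \<cdot>\<^sub>v v"
  using assms unfolding char_matrix_def
  by (subst add_mult_distrib_mat_vec[of _ n n]) (auto intro!: eq_vecI)

text \<open>The vector u = (A - a) v satisfies A u = a u, so the factors act on it by scalars. If
  \<open>a\<close> is not in \<open>es\<close>, the whole product acts on \<open>u\<close> by a
  nonzero scalar. If it is, the factor of \<open>a\<close> is moved to act first on
  \<open>v\<close>, and the remaining ones act on \<open>u\<close> by a scalar that is nonzero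
  because \<open>es\<close> is distinct.\<close>

lemma kernel_char_matrix_square:
  fixes A :: "'a::field mat"
  assumes A: "A \<in> carrier_mat n n" and "distinct es"
    and ann: "\<And>v. v \<in> carrier_vec n \<Longrightarrow> shifts A es v = 0\<^sub>v n"
    and v: "v \<in> carrier_vec n" and vv: "char_matrix A a *\<^sub>v (char_matrix A a *\<^sub>v v) = 0\<^sub>v n"
  shows "char_matrix A a *\<^sub>v v = 0\<^sub>v n"
proof -
  let ?f = "\<lambda>e u. A *\<^sub>v u - e \<cdot>\<^sub>v u"
  define u where "u = ?f a v"
  have u: "u \<in> carrier_vec n" using A v by (simp add: u_def)
  have "?f a u = 0\<^sub>v n" using vv u v A by (simp add: char_matrix_mult_vec u_def)
  then have "(?f a u + a \<cdot>\<^sub>v u) = a \<cdot>\<^sub>v u" using u by simp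
  moreover have "?f a u + a \<cdot>\<^sub>v u = A *\<^sub>v u" using u A by (intro eq_vecI) auto
  ultimately have ev: "A *\<^sub>v u = a \<cdot>\<^sub>v u" by simp
  have "u = 0\<^sub>v n"
  proof (cases "a \<in> set es")
    case False
    have "(\<Prod>e\<leftarrow>es. a - e) \<cdot>\<^sub>v u = 0\<^sub>v n" using shifts_eigenvector[OF A u ev] ann[OF u] by simp
    then show ?thesis using False u prod_list_diff_eq_0_iff[of a es]
      by (auto simp: vec_eq_iff)
  next
    case True
    then obtain es1 es2 where es: "es = es1 @ a # es2" by (auto simp: in_set_conv_decomp)
    have "shifts A (es1 @ es2) u = shifts A es v"
      using shifts_commute[OF A v, of es1 a] by (simp add: es shifts_def u_def)
    then have "(\<Prod>e\<leftarrow>es1 @ es2. a - e) \<cdot>\<^sub>v u = 0\<^sub>v n"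
      using shifts_eigenvector[OF A u ev] ann[OF v] by metis
    moreover have "(\<Prod>e\<leftarrow>es1 @ es2. a - e) \<noteq> 0"
      using assms(2) prod_list_diff_eq_0_iff[of a "es1 @ es2"] es by auto
    ultimately show ?thesis using u by (auto simp: vec_eq_iff)
  qed
  then show ?thesis using char_matrix_mult_vec[OF A v] u_def by simp
qed

lemma diagonal_jordan_matrix:
  assumes "\<And>m e. (m, e) \<in> set n_as \<Longrightarrow> m = 1"
  shows "diagonal_mat (jordan_matrix n_as)"
  using assms
proof (induction n_as)
  case Nil
  then show ?case by (simp add: diagonal_mat_def)
next
  case (Cons x n_as)
  obtain m e where x: "x = (m, e)" by force
  then have "m = 1" using Cons.prems by auto
  moreover have "diagonal_mat (jordan_matrix n_as)" using Cons by auto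
  ultimately show ?case
    by (auto simp: x diagonal_mat_def jordan_matrix_Cons jordan_block_def)
qed

text \<open>For the sizes \<open>ns\<close> of the Jordan blocks at one eigenvalue, the two sums are
  the kernel dimensions of the second and the first power; their equality excludes blocks larger
  than 1.\<close>

lemma sum_list_min_eq:
  assumes "(\<Sum>n\<leftarrow>ns. min 2 n) = (\<Sum>n\<leftarrow>ns. min 1 n)" "n \<in> set ns"
  shows "n \<le> (1::nat)"
proof -
  have le: "(\<Sum>n\<leftarrow>ns. min 1 n) \<le> (\<Sum>n\<leftarrow>ns. min 2 n)" for ns :: "nat list"
    by (rule sum_list_mono) auto
  obtain ns1 ns2 where "ns = ns1 @ n # ns2" using assms(2) by (auto simp: in_set_conv_decomp)
  then show ?thesis using assms(1) le[of ns1] le[of ns2] by (auto simp: min_def split: if_splits)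
qed

text \<open>A real Jordan form requires the characteristic polynomial to split over the reals. On
  the eigenvector of a complex root the complex annihilating product acts by a scalar, so every root
  is one of the real numbers in \<open>es\<close>. The block sizes are then bounded by comparing
  kernels.\<close>

lemma diagonalizable_if_annihilated:
  fixes A :: "real mat"
  assumes A: "A \<in> carrier_mat n n" and es: "distinct es"
    and ann: "\<And>v. v \<in> carrier_vec n \<Longrightarrow> shifts A es v = 0\<^sub>v n"
    and ann_complex: "\<And>v. v \<in> carrier_vec n \<Longrightarrow>
      shifts (map_mat complex_of_real A) (map complex_of_real es) v = 0\<^sub>v n"
  shows "diagonalizable A"
proof -
  let ?A = "map_mat complex_of_real A"
  have cA: "?A \<in> carrier_mat n n" using A by simp
  obtain as where as: "char_poly ?A = (\<Prod>a\<leftarrow>as. [:- a, 1:])"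
    using char_poly_factorized[OF cA] by auto
  have "a \<in> \<real>" if a: "a \<in> set as" for a
  proof -
    have "poly (char_poly ?A) a = 0" unfolding as using a
      by (auto simp: poly_prod_list prod_list_zero_iff)
    then have "eigenvalue ?A a" using eigenvalue_root_char_poly[OF cA] by simp
    then obtain v where v: "v \<in> carrier_vec n" "v \<noteq> 0\<^sub>v n" "?A *\<^sub>v v = a \<cdot>\<^sub>v v"
      using cA unfolding eigenvalue_def eigenvector_def by auto
    have "(\<Prod>e\<leftarrow>map complex_of_real es. a - e) \<cdot>\<^sub>v v = 0\<^sub>v n"
      using shifts_eigenvector[OF cA v(1,3)] ann_complex[OF v(1)] by metis
    then have "(\<Prod>e\<leftarrow>map complex_of_real es. a - e) = 0"
      using v(1,2) by (auto simp: vec_eq_iff)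
    then show ?thesis unfolding prod_list_diff_eq_0_iff by auto
  qed
  then have as': "as = map complex_of_real (map Re as)"
    by (auto simp: map_idI complex_is_Real_iff complex_eq_iff list_eq_iff_nth_eq)
  have "map_poly complex_of_real (char_poly A) = map_poly complex_of_real (\<Prod>a\<leftarrow>map Re as. [:- a, 1:])"
  proof -
    have "map_poly complex_of_real (char_poly A) = char_poly ?A"
      by (rule of_real_hom.char_poly_hom[OF A, symmetric])
    also have "\<dots> = (\<Prod>a\<leftarrow>map complex_of_real (map Re as). [:- a, 1:])"
      using as as' by simp
    also have "\<dots> = map_poly complex_of_real (\<Prod>a\<leftarrow>map Re as. [:- a, 1:])"
    proof -
      interpret h: map_poly_comm_ring_hom complex_of_real ..
      have "(\<Prod>a\<leftarrow>map complex_of_real bs. [:- a, 1:]) = map_poly complex_of_real (\<Prod>a\<leftarrow>bs. [:- a, 1:])" for bs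
        by (induction bs) (simp_all add: h.hom_mult map_poly_pCons del: mult_pCons_left mult_pCons_right)
      then show ?thesis .
    qed
    finally show ?thesis .
  qed
  then have "char_poly A = (\<Prod>a\<leftarrow>map Re as. [:- a, 1:])"
    unfolding poly_eq_iff by (simp add: coeff_map_poly)
  then obtain n_as where jnf: "jordan_nf A n_as" using jordan_nf_exists[OF A] by blast
  have "m = 1" if me: "(m, e) \<in> set n_as" for m e
  proof -
    have C: "char_matrix A e \<in> carrier_mat n n" using A by simp
    have sq: "char_matrix A e ^\<^sub>m 2 = char_matrix A e * char_matrix A e"
      using C by (simp add: numeral_2_eq_2)
    have "mat_kernel (char_matrix A e ^\<^sub>m 2) = mat_kernel (char_matrix A e)"
    proof (intro subset_antisym subsetI)
      fix v assume "v \<in> mat_kernel (char_matrix A e ^\<^sub>m 2)"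
      then have v: "v \<in> carrier_vec n" "char_matrix A e *\<^sub>v (char_matrix A e *\<^sub>v v) = 0\<^sub>v n"
        using C A unfolding sq mat_kernel_def by (auto simp: assoc_mult_mat_vec[of _ n n _ n])
      then show "v \<in> mat_kernel (char_matrix A e)"
        using kernel_char_matrix_square[OF A es ann] C by (intro mat_kernelI[OF C]) auto
    next
      fix v assume v: "v \<in> mat_kernel (char_matrix A e)"
      then have v: "v \<in> carrier_vec n" "char_matrix A e *\<^sub>v v = 0\<^sub>v n"
        using C unfolding mat_kernel_def by auto
      then show "v \<in> mat_kernel (char_matrix A e ^\<^sub>m 2)"
        unfolding sq using C by (intro mat_kernelI[of _ n n]) (auto simp: assoc_mult_mat_vec[of _ n n _ n])
    qed
    then have "dim_gen_eigenspace A e 2 = dim_gen_eigenspace A e 1"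
      using C by (simp add: dim_gen_eigenspace_def kernel_dim_def)
    then have "m \<le> 1"
      unfolding dim_gen_eigenspace[OF jnf] by (rule sum_list_min_eq) (use me in force)
    moreover have "m \<noteq> 0" using jnf me unfolding jordan_nf_def by force
    ultimately show "m = 1" by simp
  qed
  then have "diagonal_mat (jordan_matrix n_as)" by (rule diagonal_jordan_matrix)
  then show ?thesis using jnf unfolding diagonalizable_def jordan_nf_def by blast
qed

section \<open>Multiplicities from the traces of powers\<close>

lemma trace_mult_commute:
  fixes A B :: "'a::comm_semiring_0 mat"
  assumes "A \<in> carrier_mat n m" "B \<in> carrier_mat m n"
  shows "(\<Sum>i<n. (A * B) $$ (i, i)) = (\<Sum>i<m. (B * A) $$ (i, i))"
proof -
  have "(\<Sum>i<n. (A * B) $$ (i, i)) = (\<Sum>i<n. \<Sum>j<m. A $$ (i, j) * B $$ (j, i))"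
    using assms by (auto simp: scalar_prod_def lessThan_atLeast0 intro!: sum.cong)
  also have "\<dots> = (\<Sum>j<m. \<Sum>i<n. B $$ (j, i) * A $$ (i, j))"
    by (subst sum.swap) (simp add: mult.commute)
  also have "\<dots> = (\<Sum>i<m. (B * A) $$ (i, i))"
    using assms by (auto simp: scalar_prod_def lessThan_atLeast0 intro!: sum.cong)
  finally show ?thesis .
qed

lemma diagonal_mat_eq_mat_diag:
  "D \<in> carrier_mat n n \<Longrightarrow> diagonal_mat D \<Longrightarrow> D = mat_diag n (\<lambda>i. D $$ (i, i))"
  by (auto simp: diagonal_mat_def mat_diag_def intro!: eq_matI)

lemma mat_diag_pow: "mat_diag n f ^\<^sub>m k = mat_diag n (\<lambda>i. f i ^ k)"
  by (induction k) (simp_all add: power_commutes, simp add: mat_diag_def)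

text \<open>Equal power sums give equal sums of every polynomial, and the test polynomial
  \<open>p\<close> vanishes at all values that occur except \<open>e\<close>. Characteristic 0
  allows the remaining multiples to be compared as natural numbers.\<close>

lemma power_sums_determine_multiplicities:
  fixes d :: "'i \<Rightarrow> 'a::field_char_0" and a :: "'j \<Rightarrow> 'a" and m :: "'j \<Rightarrow> nat"
  assumes "finite I" "finite J" and pow: "\<And>k. (\<Sum>i\<in>I. d i ^ k) = (\<Sum>j\<in>J. of_nat (m j) * a j ^ k)"
  shows "card {i\<in>I. d i = e} = (\<Sum>j\<in>{j\<in>J. a j = e}. m j)"
proof -
  define p where "p = (\<Prod>b\<in>d ` I \<union> a ` J - {e}. [:- b, 1:])"
  have fin: "finite (d ` I \<union> a ` J - {e})" using assms by simp
  have p0: "poly p b = 0" if "b \<in> d ` I \<union> a ` J" "b \<noteq> e" for b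
    using that fin by (auto simp: p_def poly_prod)
  have pe: "poly p e \<noteq> 0" using fin by (auto simp: p_def poly_prod)
  have "(\<Sum>i\<in>I. poly p (d i)) = (\<Sum>k\<le>degree p. coeff p k * (\<Sum>i\<in>I. d i ^ k))"
    unfolding poly_altdef sum_distrib_left by (rule sum.swap)
  also have "\<dots> = (\<Sum>k\<le>degree p. \<Sum>j\<in>J. of_nat (m j) * (coeff p k * a j ^ k))"
    unfolding pow sum_distrib_left by (simp add: mult.left_commute)
  also have "\<dots> = (\<Sum>j\<in>J. of_nat (m j) * poly p (a j))"
    unfolding poly_altdef sum_distrib_left by (rule sum.swap)
  finally have eq: "(\<Sum>i\<in>I. poly p (d i)) = (\<Sum>j\<in>J. of_nat (m j) * poly p (a j))" .
  have "(\<Sum>i\<in>I. poly p (d i)) = (\<Sum>i\<in>{i\<in>I. d i = e}. poly p e)"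
    using assms p0 by (intro sum.mono_neutral_cong_right) auto
  moreover have "(\<Sum>j\<in>J. of_nat (m j) * poly p (a j)) = (\<Sum>j\<in>{j\<in>J. a j = e}. of_nat (m j) * poly p e)"
    using assms p0 by (intro sum.mono_neutral_cong_right) auto
  ultimately have "of_nat (card {i\<in>I. d i = e}) * poly p e
      = of_nat (\<Sum>j\<in>{j\<in>J. a j = e}. m j) * poly p e"
    using eq by (simp add: sum_distrib_right)
  then show ?thesis using pe by (simp del: of_nat_sum)
qed

lemma order_prod_linear_factors:
  fixes e :: "'a::field"
  shows "Polynomial.order e (\<Prod>b\<leftarrow>bs. [:- b, 1:]) = length (filter ((=) e) bs)"
proof (induction bs)
  case (Cons b bs)
  have "[:- b, 1:] * (\<Prod>b\<leftarrow>bs. [:- b, 1:]) \<noteq> 0" by (auto simp: prod_list_zero_iff simp del: mult_pCons_left)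
  then show ?case using Cons by (simp add: order_mult order_linear' del: mult_pCons_left)
qed simp

lemma order_char_poly_if_traces:
  fixes A :: "'a::field_char_0 mat" and m :: "'j \<Rightarrow> nat"
  assumes A: "A \<in> carrier_mat n n" and "diagonalizable A" and "finite J"
    and tr: "\<And>k. (\<Sum>i<n. (A ^\<^sub>m k) $$ (i, i)) = (\<Sum>j\<in>J. of_nat (m j) * a j ^ k)"
  shows "Polynomial.order e (char_poly A) = (\<Sum>j\<in>{j\<in>J. a j = e}. m j)"
proof -
  obtain D where D: "diagonal_mat D" "similar_mat A D"
    using assms(2) by (auto simp: diagonalizable_def)
  obtain P Q where wit: "similar_mat_wit A D P Q" using D by (auto simp: similar_mat_def)
  note PQ = similar_mat_witD2[OF A wit]
  define d where "d i = D $$ (i, i)" for i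
  have Dd: "D = mat_diag n d" unfolding d_def using diagonal_mat_eq_mat_diag PQ D by blast
  have "(\<Sum>i<n. d i ^ k) = (\<Sum>j\<in>J. of_nat (m j) * a j ^ k)" for k
  proof -
    have Dk: "D ^\<^sub>m k \<in> carrier_mat n n" using PQ by simp
    have "(\<Sum>i<n. (A ^\<^sub>m k) $$ (i, i)) = (\<Sum>i<n. (P * (D ^\<^sub>m k * Q)) $$ (i, i))"
      using similar_mat_wit_pow_id[OF wit, of k] PQ Dk by (simp add: assoc_mult_mat[of _ n n _ n _ n])
    also have "\<dots> = (\<Sum>i<n. ((D ^\<^sub>m k * Q) * P) $$ (i, i))"
      using PQ Dk by (intro trace_mult_commute) auto
    also have "(D ^\<^sub>m k * Q) * P = D ^\<^sub>m k"
      using PQ Dk by (simp add: assoc_mult_mat[of _ n n _ n _ n])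
    also have "(\<Sum>i<n. (D ^\<^sub>m k) $$ (i, i)) = (\<Sum>i<n. d i ^ k)"
      unfolding Dd mat_diag_pow by (simp add: mat_diag_def)
    finally show ?thesis using tr by simp
  qed
  then have card: "card {i\<in>{..<n}. d i = e} = (\<Sum>j\<in>{j\<in>J. a j = e}. m j)"
    using assms(3) by (intro power_sums_determine_multiplicities) auto
  have "char_poly A = char_poly D" using D by (simp add: char_poly_similar)
  also have "\<dots> = (\<Prod>b\<leftarrow>diag_mat D. [:- b, 1:])"
    using PQ D by (intro char_poly_upper_triangular[of _ n]) (auto simp: diagonal_mat_def upper_triangular_def)
  also have "\<dots> = (\<Prod>b\<leftarrow>map d [0..<n]. [:- b, 1:])"
    using PQ by (simp add: diag_mat_def d_def[abs_def])
  finally have "Polynomial.order e (char_poly A) = length (filter ((=) e) (map d [0..<n]))"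
    by (simp only: order_prod_linear_factors)
  also have "\<dots> = card {i\<in>{..<n}. d i = e}"
    unfolding length_filter_conv_card by (intro arg_cong[where f = card]) auto
  finally show ?thesis using card by simp
qed

section \<open>Walks on left regular bands\<close>

locale left_regular_band_walk =
  fixes S C :: "'a set" and mult :: "'a \<Rightarrow> 'a \<Rightarrow> 'a" (infixl "\<odot>" 70) and one :: 'a and w :: "'a \<Rightarrow> real"
  assumes finite_S: "finite S" and C_subset: "C \<subseteq> S"
    and closed: "x \<in> S \<Longrightarrow> y \<in> S \<Longrightarrow> x \<odot> y \<in> S"
    and assoc: "x \<in> S \<Longrightarrow> y \<in> S \<Longrightarrow> z \<in> S \<Longrightarrow> x \<odot> y \<odot> z = x \<odot> (y \<odot> z)"
    and left_regular: "x \<in> S \<Longrightarrow> y \<in> S \<Longrightarrow> x \<odot> y \<odot> x = x \<odot> y"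
    and one_mem: "one \<in> S" and one_left: "x \<in> S \<Longrightarrow> one \<odot> x = x" and one_right: "x \<in> S \<Longrightarrow> x \<odot> one = x"
    and ideal: "x \<in> S \<Longrightarrow> c \<in> C \<Longrightarrow> x \<odot> c \<in> C"
    and w_nonneg: "x \<in> S \<Longrightarrow> 0 \<le> w x"
begin

text \<open>The transition matrix acting on functions of the state. Values in an arbitrary real
  vector space let one computation serve the real and the complex matrix.\<close>

definition step :: "('a \<Rightarrow> 'b::real_vector) \<Rightarrow> 'a \<Rightarrow> 'b" where
  "step f c = (\<Sum>x\<in>S. w x *\<^sub>R f (x \<odot> c))"

definition weight_below :: "'a \<Rightarrow> real" where
  "weight_below s = (\<Sum>x\<in>{x\<in>S. s \<odot> x = s}. w x)"

primrec step_shifts :: "real list \<Rightarrow> ('a \<Rightarrow> 'b::real_vector) \<Rightarrow> 'a \<Rightarrow> 'b" where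
  "step_shifts [] f = f"
| "step_shifts (e # es) f = step_shifts es (\<lambda>c. step f c - e *\<^sub>R f c)"

lemma idem: "x \<in> S \<Longrightarrow> x \<odot> x = x"
  using left_regular[of x one] one_mem one_right by simp

text \<open>Writing \<open>s\<close> as \<open>s \<odot> y\<close> puts a \<open>y\<close> in front
  of \<open>x\<close>, and left regularity deletes the later one. What \<open>s\<close> absorbs is
  thus absorbed by all its right multiples, which makes \<open>weight_below\<close>
  monotone.\<close>

lemma absorb_mult:
  assumes "s \<in> S" "x \<in> S" "y \<in> S" "s \<odot> y = s"
  shows "s \<odot> x \<odot> y = s \<odot> x"
proof -
  have "s \<odot> x \<odot> y = s \<odot> y \<odot> x \<odot> y" using assms by simp
  also have "\<dots> = s \<odot> (y \<odot> x \<odot> y)" using assms(1-3) by (simp add: assoc closed)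
  also have "\<dots> = s \<odot> (y \<odot> x)" using assms by (simp add: left_regular)
  also have "\<dots> = s \<odot> x" using assms by (metis assoc)
  finally show ?thesis .
qed

text \<open>Besides everything absorbed by \<open>s\<close>, the product absorbs \<open>x\<close>
  itself, by idempotence; the positive weight of \<open>x\<close> is the gain.\<close>

lemma weight_below_mult_less:
  assumes "s \<in> S" "x \<in> S" "s \<odot> x \<noteq> s" "w x > 0"
  shows "weight_below s < weight_below (s \<odot> x)"
  unfolding weight_below_def
proof (rule sum_strict_mono2)
  show "{y \<in> S. s \<odot> y = s} \<subseteq> {y \<in> S. s \<odot> x \<odot> y = s \<odot> x}"
    using assms absorb_mult by auto
  show "x \<in> {y \<in> S. s \<odot> x \<odot> y = s \<odot> x} - {y \<in> S. s \<odot> y = s}"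
    using assms by (simp add: assoc idem)
qed (use finite_S assms w_nonneg in auto)

lemma step_cong: "(\<And>c. c \<in> C \<Longrightarrow> f c = g c) \<Longrightarrow> c \<in> C \<Longrightarrow> step f c = step g c"
  unfolding step_def by (intro sum.cong refl) (simp add: ideal)

lemma step_sum: "step (\<lambda>c. \<Sum>x\<in>X. a x *\<^sub>R F x c) = (\<lambda>c. \<Sum>x\<in>X. a x *\<^sub>R step (F x) c)"
  unfolding step_def scaleR_sum_right
  by (rule ext, subst sum.swap) (simp add: mult.commute)

lemma step_diff: "step (\<lambda>c. f c - g c) = (\<lambda>c. step f c - step g c)"
  unfolding step_def by (simp add: scaleR_diff_right sum_subtractf)

lemma step_scale: "step (\<lambda>c. a *\<^sub>R f c) = (\<lambda>c. a *\<^sub>R step f c)"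
  unfolding step_def by (simp add: scaleR_sum_right mult.commute)

lemma step_shifts_cong:
  "(\<And>c. c \<in> C \<Longrightarrow> f c = g c) \<Longrightarrow> c \<in> C \<Longrightarrow> step_shifts es f c = step_shifts es g c"
proof (induction es arbitrary: f g)
  case (Cons e es)
  show ?case unfolding step_shifts.simps
    by (rule Cons.IH) (use Cons.prems step_cong[of f g] in auto)
qed simp

lemma step_shifts_sum:
  "step_shifts es (\<lambda>c. \<Sum>x\<in>X. a x *\<^sub>R F x c) = (\<lambda>c. \<Sum>x\<in>X. a x *\<^sub>R step_shifts es (F x) c)"
proof (induction es arbitrary: F)
  case (Cons e es)
  have "(\<lambda>c. step (\<lambda>c. \<Sum>x\<in>X. a x *\<^sub>R F x c) c - e *\<^sub>R (\<Sum>x\<in>X. a x *\<^sub>R F x c))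
      = (\<lambda>c. \<Sum>x\<in>X. a x *\<^sub>R (step (F x) c - e *\<^sub>R F x c))"
    by (simp add: step_sum scaleR_diff_right sum_subtractf scaleR_sum_right mult.commute)
  then show ?case by (simp add: Cons.IH)
qed simp

lemma step_shifts_diff:
  "step_shifts es (\<lambda>c. f c - a *\<^sub>R g c) = (\<lambda>c. step_shifts es f c - a *\<^sub>R step_shifts es g c)"
proof (induction es arbitrary: f g)
  case (Cons e es)
  have "(\<lambda>c. step (\<lambda>c. f c - a *\<^sub>R g c) c - e *\<^sub>R (f c - a *\<^sub>R g c))
      = (\<lambda>c. (step f c - e *\<^sub>R f c) - a *\<^sub>R (step g c - e *\<^sub>R g c))"
    by (simp add: step_diff step_scale algebra_simps)
  then show ?case by (simp add: Cons.IH)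
qed simp

text \<open>On translates the operator multiplies \<open>s\<close> from the right by the weighted
  sum of the elements. This is how left regularity comes to bear on a walk defined by left
  multiplication.\<close>

lemma step_translate:
  assumes "s \<in> S" "c \<in> C"
  shows "step (\<lambda>c. f (s \<odot> c)) c = (\<Sum>x\<in>S. w x *\<^sub>R f (s \<odot> x \<odot> c))"
  unfolding step_def using assms C_subset by (intro sum.cong refl) (auto simp: assoc)

text \<open>
  Since the weights are nonnegative, \<open>step - \<lambda>\<^sub>s\<close> maps \<open>f(s \<odot> _)\<close> to a combination of translates
  \<open>f(s \<odot> x \<odot> _)\<close> whose values \<open>\<lambda>\<close> are strictly larger. So each value has to be removed
  only once.
\<close>

lemma step_shifts_translate:
  assumes "sorted_wrt (<) es" and "s \<in> S" "c \<in> C" "weight_below s \<in> set es"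
    and "\<And>t. t \<in> S \<Longrightarrow> weight_below s \<le> weight_below t \<Longrightarrow> weight_below t \<in> set es"
  shows "step_shifts es (\<lambda>c. f (s \<odot> c)) c = 0"
  using assms
proof (induction es arbitrary: s)
  case Nil
  then show ?case by simp
next
  case (Cons e es)
  let ?T = "\<lambda>s c. f (s \<odot> c)"
  \<comment> \<open>The list is sorted, so \<open>e\<close> is its least entry: a weight that is at
    least that of \<open>s\<close> and differs from \<open>e\<close> exceeds \<open>e\<close>, and
    it and all larger weights lie in the tail.\<close>
  have vanish: "step_shifts es (?T t) c = 0"
    if t: "t \<in> S" "weight_below s \<le> weight_below t" "weight_below t \<noteq> e" for t
  proof (rule Cons.IH)
    have mem: "weight_below u \<in> set es" if "u \<in> S" "weight_below t \<le> weight_below u" for u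
    proof -
      have "weight_below t \<in> set (e # es)" "weight_below u \<in> set (e # es)"
        using Cons.prems(5)[of t] Cons.prems(5)[of u] t that by auto
      then show ?thesis using Cons.prems(1) t that by auto
    qed
    then show "weight_below t \<in> set es" using t by auto
    show "weight_below u \<in> set es" if "u \<in> S" "weight_below t \<le> weight_below u" for u
      using mem that .
  qed (use Cons.prems t in auto)
  have e_le: "e \<le> weight_below s" using Cons.prems(1,4) by auto
  have "step_shifts (e # es) (?T s) c
      = step_shifts es (\<lambda>c. (\<Sum>x\<in>S. w x *\<^sub>R ?T (s \<odot> x) c) - e *\<^sub>R ?T s c) c"
    unfolding step_shifts.simps
    by (rule step_shifts_cong) (use Cons.prems step_translate in auto)
  also have "\<dots> = (\<Sum>x\<in>S. w x *\<^sub>R step_shifts es (?T (s \<odot> x)) c) - e *\<^sub>R step_shifts es (?T s) c"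
    unfolding step_shifts_diff step_shifts_sum ..
  also have "(\<Sum>x\<in>S. w x *\<^sub>R step_shifts es (?T (s \<odot> x)) c)
      = (\<Sum>x\<in>{x\<in>S. s \<odot> x = s}. w x *\<^sub>R step_shifts es (?T s) c)"
  proof (rule sum.mono_neutral_cong_right)
    show "\<forall>x\<in>S - {x\<in>S. s \<odot> x = s}. w x *\<^sub>R step_shifts es (?T (s \<odot> x)) c = 0"
    proof
      fix x assume x: "x \<in> S - {x\<in>S. s \<odot> x = s}"
      show "w x *\<^sub>R step_shifts es (?T (s \<odot> x)) c = 0"
      proof (cases "w x = 0")
        case False
        then have "w x > 0" using w_nonneg[of x] x by auto
        then have "weight_below s < weight_below (s \<odot> x)"
          using Cons.prems x by (intro weight_below_mult_less) auto
        then show ?thesis using vanish[of "s \<odot> x"] e_le Cons.prems x closed by auto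
      qed simp
    qed
  qed (use finite_S in auto)
  also have "\<dots> = weight_below s *\<^sub>R step_shifts es (?T s) c"
    by (simp add: weight_below_def scaleR_sum_left)
  also have "\<dots> - e *\<^sub>R step_shifts es (?T s) c = 0"
    \<comment> \<open>Either the weight of \<open>s\<close> is \<open>e\<close> and the two terms
      cancel, or it exceeds \<open>e\<close> and the tail alone already annihilates the translate by
      \<open>s\<close>.\<close>
    using vanish[of s] Cons.prems by (cases "weight_below s = e") auto
  finally show ?case .
qed

lemma step_shifts_eq_0:
  assumes "c \<in> C"
  shows "step_shifts (sorted_list_of_set (weight_below ` S)) f c = 0"
proof -
  have "step_shifts (sorted_list_of_set (weight_below ` S)) (\<lambda>c. f (one \<odot> c)) c = 0"
    using finite_S assms one_mem by (intro step_shifts_translate) auto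
  moreover have "step_shifts (sorted_list_of_set (weight_below ` S)) (\<lambda>c. f (one \<odot> c)) c
      = step_shifts (sorted_list_of_set (weight_below ` S)) f c"
    by (rule step_shifts_cong) (use assms one_left C_subset in auto)
  ultimately show ?thesis by simp
qed

section \<open>Traces of the powers of the walk operator\<close>

lemma step_pow_cong:
  "(\<And>c. c \<in> C \<Longrightarrow> f c = g c) \<Longrightarrow> c \<in> C \<Longrightarrow> (step ^^ k) f c = (step ^^ k) g c"
  by (induction k arbitrary: f g c) (auto intro: step_cong)

lemma step_pow_sum:
  "(step ^^ k) (\<lambda>c. \<Sum>x\<in>X. a x *\<^sub>R F x c) = (\<lambda>c. \<Sum>x\<in>X. a x *\<^sub>R (step ^^ k) (F x) c)"
  by (induction k) (simp_all add: step_sum)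

text \<open>The left factor \<open>s\<close> closes the induction, since one step replaces it by
  \<open>s \<odot> x\<close>. As \<open>below\<close> turns products into conjunctions, the sum over
  \<open>x\<close> splits off one more factor of the eigenvalue of each index. For exponent 0 the
  trace counts the fixed points of \<open>s\<close>.\<close>

lemma trace_step_pow_translate:
  fixes below :: "'a \<Rightarrow> 'i \<Rightarrow> bool" and m :: "'i \<Rightarrow> nat"
  assumes I: "finite I"
    and below: "\<And>x y i. x \<in> S \<Longrightarrow> y \<in> S \<Longrightarrow> i \<in> I \<Longrightarrow> below (x \<odot> y) i \<longleftrightarrow> below x i \<and> below y i"
    and fixpts: "\<And>s. s \<in> S \<Longrightarrow> card {c\<in>C. s \<odot> c = c} = (\<Sum>i\<in>{i\<in>I. below s i}. m i)"
    and s: "s \<in> S"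
  shows "(\<Sum>d\<in>C. (step ^^ k) (\<lambda>c. of_bool (s \<odot> c = d)) d)
    = (\<Sum>i\<in>{i\<in>I. below s i}. real (m i) * (\<Sum>x\<in>{x\<in>S. below x i}. w x) ^ k)"
  using s
proof (induction k arbitrary: s)
  case 0
  have "finite C" using finite_S C_subset finite_subset by blast
  then have "(\<Sum>d\<in>C. of_bool (s \<odot> d = d)) = real (card {c\<in>C. s \<odot> c = c})"
    by (simp add: of_bool_def sum.If_cases Int_def)
  then show ?case using fixpts[OF 0] by simp
next
  case (Suc k)
  let ?\<delta> = "\<lambda>s d c. of_bool (s \<odot> c = d) :: real"
  let ?ev = "\<lambda>i. \<Sum>x\<in>{x\<in>S. below x i}. w x"
  have "(step ^^ Suc k) (?\<delta> s d) d = (\<Sum>x\<in>S. w x * (step ^^ k) (?\<delta> (s \<odot> x) d) d)" if d: "d \<in> C" for d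
  proof -
    have "(step ^^ Suc k) (?\<delta> s d) d = (step ^^ k) (step (?\<delta> s d)) d"
      by (simp add: funpow_swap1)
    also have "\<dots> = (step ^^ k) (\<lambda>c. \<Sum>x\<in>S. w x *\<^sub>R ?\<delta> (s \<odot> x) d c) d"
      by (rule step_pow_cong[OF _ d]) (rule step_translate[OF Suc.prems])
    also have "\<dots> = (\<Sum>x\<in>S. w x * (step ^^ k) (?\<delta> (s \<odot> x) d) d)"
      by (simp add: step_pow_sum del: real_scaleR_def) simp
    finally show ?thesis .
  qed
  then have "(\<Sum>d\<in>C. (step ^^ Suc k) (?\<delta> s d) d) = (\<Sum>d\<in>C. \<Sum>x\<in>S. w x * (step ^^ k) (?\<delta> (s \<odot> x) d) d)"
    by (rule sum.cong[OF refl])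
  also have "\<dots> = (\<Sum>x\<in>S. w x * (\<Sum>d\<in>C. (step ^^ k) (?\<delta> (s \<odot> x) d) d))"
    by (subst sum.swap) (simp add: sum_distrib_left)
  also have "\<dots> = (\<Sum>x\<in>S. w x * (\<Sum>i\<in>{i\<in>I. below (s \<odot> x) i}. real (m i) * ?ev i ^ k))"
    using Suc.prems closed by (intro sum.cong refl) (simp only: Suc.IH)
  also have "\<dots> = (\<Sum>x\<in>S. \<Sum>i\<in>{i\<in>{i\<in>I. below s i}. below x i}. real (m i) * ?ev i ^ k * w x)"
  proof (rule sum.cong[OF refl])
    fix x assume x: "x \<in> S"
    have "{i\<in>I. below (s \<odot> x) i} = {i\<in>{i\<in>I. below s i}. below x i}"
      using below[OF Suc.prems x] by auto
    then show "w x * (\<Sum>i\<in>{i\<in>I. below (s \<odot> x) i}. real (m i) * ?ev i ^ k)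
        = (\<Sum>i\<in>{i\<in>{i\<in>I. below s i}. below x i}. real (m i) * ?ev i ^ k * w x)"
      by (simp add: sum_distrib_left mult.commute)
  qed
  also have "\<dots> = (\<Sum>i\<in>{i\<in>I. below s i}. \<Sum>x\<in>{x\<in>S. below x i}. real (m i) * ?ev i ^ k * w x)"
    using I finite_S by (intro sum.swap_restrict) auto
  also have "\<dots> = (\<Sum>i\<in>{i\<in>I. below s i}. real (m i) * ?ev i ^ Suc k)"
    by (simp only: sum_distrib_left[symmetric] power_Suc2 mult.assoc)
  finally show ?case .
qed

definition transition :: "'a \<Rightarrow> 'a \<Rightarrow> real" where
  "transition c d = (\<Sum>x\<in>{x\<in>S. x \<odot> c = d}. w x)"

lemma sum_transition:
  fixes f :: "'a \<Rightarrow> 'b::real_vector"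
  assumes "c \<in> C"
  shows "(\<Sum>d\<in>C. transition c d *\<^sub>R f d) = step f c"
proof -
  have "(\<Sum>d\<in>C. transition c d *\<^sub>R f d) = (\<Sum>d\<in>C. \<Sum>x\<in>{x\<in>S. x \<odot> c = d}. w x *\<^sub>R f (x \<odot> c))"
    unfolding transition_def scaleR_sum_left by (intro sum.cong refl) auto
  also have "\<dots> = step f c"
    unfolding step_def using assms finite_S C_subset ideal
    by (intro sum.group) (auto intro: finite_subset)
  finally show ?thesis .
qed

end

locale left_regular_band_walk_matrix = left_regular_band_walk S C mult one w
  for S C :: "'a set" and mult (infixl "\<odot>" 70) and one w +
  fixes cs :: "'a list"
  assumes distinct_cs: "distinct cs" and set_cs: "set cs = C"
begin

definition matrix :: "real mat" where
  "matrix = Matrix.mat (length cs) (length cs) (\<lambda>(i, j). transition (cs ! i) (cs ! j))"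

lemma matrix_carrier: "matrix \<in> carrier_mat (length cs) (length cs)"
  by (simp add: matrix_def)

definition vec_of :: "('a \<Rightarrow> 'b) \<Rightarrow> 'b Matrix.vec" where
  "vec_of f = Matrix.vec (length cs) (\<lambda>i. f (cs ! i))"

lemma vec_of_carrier: "vec_of f \<in> carrier_vec (length cs)"
  by (simp add: vec_of_def)

lemma sum_nth_cs: "(\<Sum>j<length cs. g (cs ! j)) = (\<Sum>d\<in>C. g d)"
  using bij_betw_nth[OF distinct_cs refl set_cs[symmetric]] by (rule sum.reindex_bij_betw)

lemma matrix_mult_vec_of:
  fixes f :: "'a \<Rightarrow> 'b::real_normed_field"
  shows "map_mat of_real matrix *\<^sub>v vec_of f = vec_of (step f)"
proof (rule eq_vecI)
  fix i assume "i < dim_vec (vec_of (step f))"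
  then have i: "i < length cs" by (simp add: vec_of_def)
  then have ci: "cs ! i \<in> C" using set_cs nth_mem by blast
  have "vec_index (map_mat of_real matrix *\<^sub>v vec_of f) i
      = (\<Sum>j<length cs. of_real (transition (cs ! i) (cs ! j)) * f (cs ! j))"
    using i by (simp add: matrix_def vec_of_def scalar_prod_def lessThan_atLeast0)
  also have "\<dots> = (\<Sum>d\<in>C. transition (cs ! i) d *\<^sub>R f d)"
    unfolding scaleR_conv_of_real by (rule sum_nth_cs)
  also have "\<dots> = step f (cs ! i)" by (rule sum_transition[OF ci])
  finally show "vec_index (map_mat of_real matrix *\<^sub>v vec_of f) i = vec_index (vec_of (step f)) i"
    using i by (simp add: vec_of_def)
qed (simp add: matrix_def vec_of_def)

lemma vec_of_surj:
  assumes "v \<in> carrier_vec (length cs)"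
  obtains f where "v = vec_of f"
proof -
  define f where "f c = vec_index v (SOME i. i < length cs \<and> cs ! i = c)" for c
  have "(SOME j. j < length cs \<and> cs ! j = cs ! i) = i" if "i < length cs" for i
    using that distinct_cs by (auto simp: nth_eq_iff_index_eq intro!: some_equality)
  then have "v = vec_of f" using assms by (intro eq_vecI) (auto simp: vec_of_def f_def)
  then show ?thesis by (rule that)
qed

lemma shifts_vec_of:
  fixes f :: "'a \<Rightarrow> 'b::real_normed_field"
  shows "shifts (map_mat of_real matrix) (map of_real es) (vec_of f) = vec_of (step_shifts es f)"
proof (induction es arbitrary: f)
  case (Cons e es)
  have "map_mat of_real matrix *\<^sub>v vec_of f - of_real e \<cdot>\<^sub>v vec_of f = vec_of (\<lambda>c. step f c - e *\<^sub>R f c)"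
    unfolding matrix_mult_vec_of by (intro eq_vecI) (auto simp: vec_of_def scaleR_conv_of_real)
  then show ?case by (simp add: Cons.IH)
qed simp

lemma shifts_matrix_eq_0:
  fixes v :: "'b::real_normed_field Matrix.vec"
  assumes "v \<in> carrier_vec (length cs)"
  shows "shifts (map_mat of_real matrix) (map of_real (sorted_list_of_set (weight_below ` S))) v
    = 0\<^sub>v (length cs)"
proof -
  obtain f where f: "v = vec_of f" using assms by (rule vec_of_surj)
  have "cs ! i \<in> C" if "i < length cs" for i using that set_cs nth_mem by blast
  then show ?thesis unfolding f shifts_vec_of
    by (intro eq_vecI) (auto simp: vec_of_def step_shifts_eq_0)
qed

theorem diagonalizable_matrix: "diagonalizable matrix"
proof (rule diagonalizable_if_annihilated[OF matrix_carrier])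
  let ?es = "sorted_list_of_set (weight_below ` S)"
  show "distinct ?es" by simp
  have id: "map_mat of_real matrix = matrix" "map of_real ?es = ?es"
    by (auto intro!: eq_matI map_idI)
  show "shifts matrix ?es v = 0\<^sub>v (length cs)" if "v \<in> carrier_vec (length cs)" for v
    using shifts_matrix_eq_0[OF that] unfolding id .
  show "shifts (map_mat complex_of_real matrix) (map complex_of_real ?es) v = 0\<^sub>v (length cs)"
    if "v \<in> carrier_vec (length cs)" for v
    using shifts_matrix_eq_0[OF that] .
qed

lemma matrix_pow_vec_of:
  fixes f :: "'a \<Rightarrow> real"
  shows "matrix ^\<^sub>m k *\<^sub>v vec_of f = vec_of ((step ^^ k) f)"
proof (induction k arbitrary: f)
  case 0
  then show ?case using one_mult_mat_vec[OF vec_of_carrier] by (simp add: matrix_def)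
next
  case (Suc k)
  have id: "map_mat of_real matrix = matrix" by (intro eq_matI) auto
  have "matrix ^\<^sub>m Suc k *\<^sub>v vec_of f = matrix ^\<^sub>m k *\<^sub>v (matrix *\<^sub>v vec_of f)"
    using assoc_mult_mat_vec[OF pow_carrier_mat[OF matrix_carrier] matrix_carrier vec_of_carrier] by simp
  also have "\<dots> = vec_of ((step ^^ k) (step f))"
    using matrix_mult_vec_of[of f] unfolding id by (simp only: Suc.IH)
  finally show ?case by (simp add: funpow_swap1)
qed

lemma trace_matrix_pow:
  "(\<Sum>i<length cs. (matrix ^\<^sub>m k) $$ (i, i)) = (\<Sum>d\<in>C. (step ^^ k) (\<lambda>c. of_bool (c = d)) d)"
proof -
  let ?n = "length cs"
  have "(matrix ^\<^sub>m k) $$ (i, i) = (step ^^ k) (\<lambda>c. of_bool (c = cs ! i)) (cs ! i)" if i: "i < ?n" for i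
  proof -
    have M: "matrix ^\<^sub>m k \<in> carrier_mat ?n ?n" using matrix_carrier by simp
    have u: "vec_of (\<lambda>c. of_bool (c = cs ! i)) = (unit_vec ?n i :: real Matrix.vec)"
      using i distinct_cs by (intro eq_vecI) (auto simp: vec_of_def unit_vec_def nth_eq_iff_index_eq)
    have "vec_index (matrix ^\<^sub>m k *\<^sub>v unit_vec ?n i) i = scalar_prod (row (matrix ^\<^sub>m k) i) (unit_vec ?n i)"
      using M i by (intro index_mult_mat_vec) auto
    also have "\<dots> = vec_index (row (matrix ^\<^sub>m k) i) i"
      using M by (intro scalar_prod_right_unit[OF i])
    also have "\<dots> = (matrix ^\<^sub>m k) $$ (i, i)" using M i by (intro index_row(1)) auto
    finally have "(matrix ^\<^sub>m k) $$ (i, i) = vec_index (matrix ^\<^sub>m k *\<^sub>v unit_vec ?n i) i" ..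
    then show ?thesis using i by (simp add: u[symmetric] matrix_pow_vec_of) (simp add: vec_of_def)
  qed
  then have "(\<Sum>i<?n. (matrix ^\<^sub>m k) $$ (i, i)) = (\<Sum>i<?n. (step ^^ k) (\<lambda>c. of_bool (c = cs ! i)) (cs ! i))"
    by (intro sum.cong refl) auto
  also have "\<dots> = (\<Sum>d\<in>C. (step ^^ k) (\<lambda>c. of_bool (c = d)) d)" by (rule sum_nth_cs)
  finally show ?thesis .
qed

theorem order_char_poly_matrix:
  fixes below :: "'a \<Rightarrow> 'i \<Rightarrow> bool" and m :: "'i \<Rightarrow> nat"
  assumes I: "finite I"
    and below: "\<And>x y i. x \<in> S \<Longrightarrow> y \<in> S \<Longrightarrow> i \<in> I \<Longrightarrow> below (x \<odot> y) i \<longleftrightarrow> below x i \<and> below y i"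
    and below_one: "\<And>i. i \<in> I \<Longrightarrow> below one i"
    and fixpts: "\<And>s. s \<in> S \<Longrightarrow> card {c\<in>C. s \<odot> c = c} = (\<Sum>i\<in>{i\<in>I. below s i}. m i)"
  shows "Polynomial.order e (char_poly matrix)
    = (\<Sum>i\<in>{i\<in>I. (\<Sum>x\<in>{x\<in>S. below x i}. w x) = e}. m i)"
proof (rule order_char_poly_if_traces[OF matrix_carrier diagonalizable_matrix I])
  fix k
  let ?ev = "\<lambda>i. \<Sum>x\<in>{x\<in>S. below x i}. w x"
  have "(\<Sum>i<length cs. (matrix ^\<^sub>m k) $$ (i, i)) = (\<Sum>d\<in>C. (step ^^ k) (\<lambda>c. of_bool (one \<odot> c = d)) d)"
    unfolding trace_matrix_pow
    by (intro sum.cong refl step_pow_cong) (use one_left C_subset in auto)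
  also have "\<dots> = (\<Sum>i\<in>{i\<in>I. below one i}. real (m i) * ?ev i ^ k)"
    by (rule trace_step_pow_translate) (use I below fixpts one_mem in auto)
  also have "{i\<in>I. below one i} = I" using below_one by auto
  finally show "(\<Sum>i<length cs. (matrix ^\<^sub>m k) $$ (i, i)) = (\<Sum>i\<in>I. of_nat (m i) * ?ev i ^ k)" .
qed

end

section \<open>Stationary distributions\<close>

context left_regular_band_walk
begin

lemma transition_nonneg: "0 \<le> transition c d"
  unfolding transition_def by (intro sum_nonneg) (auto simp: w_nonneg)

lemma transition_pos:
  assumes "x \<in> S" "w x > 0"
  shows "transition c (x \<odot> c) > 0"
  unfolding transition_def using assms finite_S w_nonneg by (intro sum_pos2[of _ x]) auto

lemma finite_C: "finite C"
  using finite_S C_subset finite_subset by blast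

lemma sum_transition_eq_1:
  assumes "(\<Sum>x\<in>S. w x) = 1" "c \<in> C"
  shows "(\<Sum>d\<in>C. transition c d) = 1"
  using sum_transition[OF assms(2), of "\<lambda>_. 1 :: real"] assms(1) by (simp add: step_def)

text \<open>Row vectors fixed by the walk, with sign and total mass left free so that differences of
  stationary distributions and their absolute values are covered.\<close>

definition invariant :: "('a \<Rightarrow> real) \<Rightarrow> bool" where
  "invariant u \<longleftrightarrow> (\<forall>d\<in>C. (\<Sum>c\<in>C. u c * transition c d) = u d)"

text \<open>
  The triangle inequality gives \<open>\<bar>u\<bar> \<le> \<bar>u\<bar>P\<close>, and both sides have the same sum.
\<close>

lemma invariant_abs:
  assumes w1: "(\<Sum>x\<in>S. w x) = 1" and u: "invariant u"
  shows "invariant (\<lambda>c. \<bar>u c\<bar>)"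
proof -
  let ?P = "\<lambda>d. \<Sum>c\<in>C. \<bar>u c\<bar> * transition c d"
  have le: "\<bar>u d\<bar> \<le> ?P d" if "d \<in> C" for d
  proof -
    have "\<bar>u d\<bar> = \<bar>\<Sum>c\<in>C. u c * transition c d\<bar>" using u that by (simp add: invariant_def)
    also have "\<dots> \<le> (\<Sum>c\<in>C. \<bar>u c * transition c d\<bar>)" by (rule sum_abs)
    also have "\<dots> = ?P d" by (simp add: abs_mult transition_nonneg)
    finally show ?thesis .
  qed
  have "(\<Sum>d\<in>C. ?P d) = (\<Sum>c\<in>C. \<bar>u c\<bar> * (\<Sum>d\<in>C. transition c d))"
    by (subst sum.swap) (simp add: sum_distrib_left)
  also have "\<dots> = (\<Sum>c\<in>C. \<bar>u c\<bar>)" by (simp add: sum_transition_eq_1[OF w1])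
  finally have "(\<Sum>d\<in>C. ?P d - \<bar>u d\<bar>) = 0" by (simp add: sum_subtractf)
  then have "\<forall>d\<in>C. ?P d - \<bar>u d\<bar> = 0"
    using le finite_C by (subst (asm) sum_nonneg_eq_0_iff) auto
  then show ?thesis by (simp add: invariant_def)
qed

lemma invariant_linear:
  assumes "invariant u" "invariant v"
  shows "invariant (\<lambda>c. a * u c + b * v c)"
proof -
  have "(\<Sum>c\<in>C. (a * u c + b * v c) * transition c d)
      = a * (\<Sum>c\<in>C. u c * transition c d) + b * (\<Sum>c\<in>C. v c * transition c d)" for d
    by (simp add: sum_distrib_left sum.distrib distrib_right mult.assoc)
  then show ?thesis using assms by (simp add: invariant_def)
qed

text \<open>In the balance equation at \<open>x \<odot> c\<close> the term of \<open>c\<close> alone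
  is already positive and no other term is negative.\<close>

lemma invariant_pos_closed:
  assumes u: "invariant u" and nonneg: "\<And>c. c \<in> C \<Longrightarrow> 0 \<le> u c"
    and c: "c \<in> C" "u c > 0" and x: "x \<in> S" "w x > 0"
  shows "u (x \<odot> c) > 0"
proof -
  have "0 < (\<Sum>c'\<in>C. u c' * transition c' (x \<odot> c))"
    using c x nonneg finite_C transition_nonneg transition_pos by (intro sum_pos2[of _ c]) auto
  then show ?thesis using u ideal[OF x(1) c(1)] by (simp add: invariant_def)
qed

end

context left_regular_band_walk_matrix
begin

text \<open>The rows sum to 1, so 1 is an eigenvalue; the transpose has the same characteristic
  polynomial, which yields a fixed row vector. Its entries may have both signs, which
  \<open>invariant_abs\<close> repairs later.\<close>

lemma exists_invariant:
  assumes w1: "(\<Sum>x\<in>S. w x) = 1" and "C \<noteq> {}"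
  obtains u where "invariant u" "\<exists>c\<in>C. u c \<noteq> 0"
proof -
  let ?n = "length cs"
  have id: "map_mat of_real matrix = matrix" by (intro eq_matI) auto
  have step1: "step (\<lambda>_. 1 :: real) c = 1" for c using w1 by (simp add: step_def)
  have "matrix *\<^sub>v vec_of (\<lambda>_. 1) = vec_of (\<lambda>_. 1 :: real)"
    using matrix_mult_vec_of[of "\<lambda>_. 1 :: real"] unfolding id step1[abs_def] .
  moreover have "?n \<noteq> 0" using assms(2) set_cs by auto
  then have "vec_of (\<lambda>_. 1 :: real) \<noteq> 0\<^sub>v ?n"
    by (auto simp: vec_of_def vec_eq_iff)
  ultimately have "eigenvalue matrix 1"
    using vec_of_carrier[of "\<lambda>_. 1 :: real"] matrix_carrier unfolding eigenvalue_def eigenvector_def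
    by (intro exI[of _ "vec_of (\<lambda>_. 1)"]) auto
  then have "eigenvalue (transpose_mat matrix) 1"
    using eigenvalue_root_char_poly[OF matrix_carrier]
      eigenvalue_root_char_poly[OF transpose_carrier_mat[THEN iffD2, OF matrix_carrier]]
      char_poly_transpose_mat[OF matrix_carrier] by simp
  then obtain v where v: "v \<in> carrier_vec ?n" "v \<noteq> 0\<^sub>v ?n" "transpose_mat matrix *\<^sub>v v = v"
    using matrix_carrier unfolding eigenvalue_def eigenvector_def by auto
  obtain u where u: "v = vec_of u" using v(1) by (rule vec_of_surj)
  have "(\<Sum>c\<in>C. u c * transition c d) = u d" if "d \<in> C" for d
  proof -
    obtain i where i: "i < ?n" "d = cs ! i" using \<open>d \<in> C\<close> set_cs by (metis in_set_conv_nth)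
    have "u d = vec_index (transpose_mat matrix *\<^sub>v v) i" using v(3) i u by (simp add: vec_of_def)
    also have "\<dots> = (\<Sum>j<?n. transition (cs ! j) d * u (cs ! j))"
      using i u by (simp add: matrix_def vec_of_def scalar_prod_def lessThan_atLeast0)
    also have "\<dots> = (\<Sum>c\<in>C. transition c d * u c)" by (rule sum_nth_cs)
    finally show ?thesis by (simp add: mult.commute)
  qed
  moreover have "\<exists>c\<in>C. u c \<noteq> 0"
  proof (rule ccontr)
    assume "\<not> (\<exists>c\<in>C. u c \<noteq> 0)"
    then have "u (cs ! i) = 0" if "i < ?n" for i using that set_cs nth_mem by blast
    then have "v = 0\<^sub>v ?n" using u by (intro eq_vecI) (auto simp: vec_of_def)
    then show False using v(2) by simp
  qed
  ultimately show ?thesis using that by (auto simp: invariant_def)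
qed

text \<open>
  For two invariant distributions, the positive and the negative part of the difference are
  invariant; if both were nonzero, both would be positive at \<open>c\<^sub>0\<close>.
\<close>

theorem unique_invariant_distribution:
  assumes w1: "(\<Sum>x\<in>S. w x) = 1" and c0: "c\<^sub>0 \<in> C"
    and reach: "\<And>u c. invariant u \<Longrightarrow> (\<And>c. c \<in> C \<Longrightarrow> 0 \<le> u c) \<Longrightarrow> c \<in> C \<Longrightarrow> u c > 0 \<Longrightarrow> u c\<^sub>0 > 0"
  shows "\<exists>!p. distribution_on C p \<and> invariant p"
proof (rule ex_ex1I)
  obtain u c where u: "invariant u" "c \<in> C" "u c \<noteq> 0" using exists_invariant[OF w1] c0 by blast
  define s where "s = (\<Sum>c\<in>C. \<bar>u c\<bar>)"
  have s: "s > 0" unfolding s_def using u finite_C by (intro sum_pos2[of _ c]) auto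
  define p where "p c = (if c \<in> C then \<bar>u c\<bar> / s else 0)" for c
  have "invariant (\<lambda>c. (1 / s) * \<bar>u c\<bar> + 0 * \<bar>u c\<bar>)"
    using invariant_abs[OF w1 u(1)] by (intro invariant_linear)
  then have "invariant p" by (simp add: invariant_def p_def)
  moreover have "distribution_on C p"
    using s by (auto simp: distribution_on_def p_def s_def simp flip: sum_divide_distrib)
  ultimately show "\<exists>p. distribution_on C p \<and> invariant p" by blast
next
  fix p q assume p: "distribution_on C p \<and> invariant p" and q: "distribution_on C q \<and> invariant q"
  define u where "u c = p c - q c" for c
  have u: "invariant u"
    using invariant_linear[of p q 1 "-1"] p q by (simp add: u_def[abs_def])
  have sum0: "(\<Sum>c\<in>C. u c) = 0" using p q by (simp add: u_def sum_subtractf distribution_on_def)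
  \<comment> \<open>For \<open>a\<close> equal to 1 and -1 these are twice the positive and twice
    the negative part of \<open>u\<close>.\<close>
  have inv: "invariant (\<lambda>c. 1 * \<bar>u c\<bar> + a * u c)" for a
    using invariant_abs[OF w1 u] u by (rule invariant_linear)
  have pos: "1 * \<bar>u c\<^sub>0\<bar> + a * u c\<^sub>0 > 0" if "a = 1 \<or> a = -1" "c \<in> C" "a * u c > 0" for a c
    by (rule reach[OF inv]) (use that in auto)
  have "\<not> ((\<exists>c\<in>C. u c > 0) \<and> (\<exists>c\<in>C. u c < 0))"
    using pos[of 1] pos[of "-1"] by force
  then consider "\<And>c. c \<in> C \<Longrightarrow> 0 \<le> u c" | "\<And>c. c \<in> C \<Longrightarrow> 0 \<le> - u c" by force
  then have "\<forall>c\<in>C. u c = 0"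
  proof cases
    case 1
    then show ?thesis using sum_nonneg_eq_0_iff[OF finite_C, of u] sum0 by auto
  next
    case 2
    then show ?thesis
      using sum_nonneg_eq_0_iff[OF finite_C, of "\<lambda>c. - u c"] sum0 by (auto simp: sum_negf)
  qed
  then show "p = q" using p q by (intro ext) (auto simp: u_def distribution_on_def)
qed

end

section \<open>The interval semigroup of an arrangement\<close>

lemma int_comp_assoc: "x \<circ>\<^sub>I y \<circ>\<^sub>I z = x \<circ>\<^sub>I (y \<circ>\<^sub>I z)"
  by (cases x; cases y; cases z) (simp add: face_comp_def fun_eq_iff)

lemma int_comp_left_regular: "x \<circ>\<^sub>I y \<circ>\<^sub>I x = x \<circ>\<^sub>I y"
  by (cases x; cases y) (simp add: face_comp_def fun_eq_iff)

lemma face_comp_zero [simp]: "(\<lambda>_. Zero) \<circ>\<^sub>F X = X" "X \<circ>\<^sub>F (\<lambda>_. Zero) = X"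
  by (simp_all add: face_comp_def fun_eq_iff)

lemma face_le_comp_comp: "X \<le> X \<circ>\<^sub>F Y \<circ>\<^sub>F Z"
  by (simp add: face_comp_assoc face_le_comp)

context real_arrangement
begin

lemma zero_face: "(\<lambda>_. Zero) \<in> faces l"
  unfolding faces_def by (rule range_eqI[of _ _ 0]) (simp add: sign_vector_def fun_eq_iff sign_of_def)

lemma zero_face_span_subset:
  assumes "\<beta> \<in> flats l"
  shows "face_span l (\<lambda>_. Zero) \<subseteq> \<beta>"
proof -
  obtain S where "\<beta> = {v. \<forall>k\<in>S. l k v = 0}" using assms flats_iff by auto
  then show ?thesis using face_span_subset_iff[OF _ zero_face] by simp
qed

lemma int_comp_mem_fib:
  assumes "\<pi> \<in> flats l" "x \<in> fib l \<pi>" "y \<in> fib l \<pi>"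
  shows "x \<circ>\<^sub>I y \<in> fib l \<pi>"
  using assms
  by (cases x; cases y)
     (simp add: fib_def int_faces_def faces_comp face_span_comp_subset_iff face_le_comp_comp)

lemma int_comp_mem_max_fib:
  assumes \<pi>: "\<pi> \<in> flats l" and "x \<in> fib l \<pi>" "c \<in> max_fib l \<pi>"
  shows "x \<circ>\<^sub>I c \<in> max_fib l \<pi>"
proof -
  obtain Y X R S where [simp]: "x = (Y, X)" "c = (R, S)" by fastforce
  have *: "Y \<in> faces l" "X \<in> faces l" "R \<in> faces l" "S \<in> faces l" "face_span l Y \<subseteq> \<pi>"
    "face_span l R = \<pi>" "face_span l S = UNIV"
    using assms by (auto simp: fib_def max_fib_def int_faces_def)
  have YR: "Y \<circ>\<^sub>F R \<in> faces l" and all: "Y \<circ>\<^sub>F R \<circ>\<^sub>F X \<circ>\<^sub>F S \<in> faces l"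
    using * by (auto intro!: faces_comp)
  have "face_span l (Y \<circ>\<^sub>F R) = \<pi>"
    using face_span_comp_subset_iff[OF face_span_flat[OF YR] *(1,3)]
      face_span_comp_subset_iff[OF \<pi> *(1,3)] * by auto
  moreover have "face_span l (Y \<circ>\<^sub>F R \<circ>\<^sub>F X \<circ>\<^sub>F S) = UNIV"
    using face_span_comp_subset_iff[OF face_span_flat[OF all] faces_comp[OF YR *(2)] *(4)] * by auto
  ultimately show ?thesis
    using YR all by (simp add: max_fib_def int_faces_def face_le_comp_comp)
qed

lemma max_fib_subset: "max_fib l \<pi> \<subseteq> fib l \<pi>"
  by (auto simp: max_fib_def fib_def)

lemma face_comp_absorb:
  assumes "X \<in> faces l" "Y \<in> faces l" "face_span l Y \<subseteq> face_span l X"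
  shows "X \<circ>\<^sub>F Y = X"
proof -
  have "Y k = Zero" if "X k = Zero" for k
    using face_span_subset_iff[of "face_span l X" "{k. X k = Zero}" Y] assms that
    by (auto simp: face_span_eq)
  then show ?thesis by (auto simp: face_comp_def fun_eq_iff)
qed

text \<open>Both faces of a maximal element already have the largest span possible in the fibre, so
  a factor on the right has no zero entry left to fill. Maximal elements are therefore left zeros,
  which later supplies a state reachable from everywhere.\<close>

lemma max_fib_absorb:
  assumes "x \<in> max_fib l \<pi>" "y \<in> fib l \<pi>"
  shows "x \<circ>\<^sub>I y = x"
proof -
  obtain Y X R S where [simp]: "x = (R, S)" "y = (Y, X)" by fastforce
  have *: "Y \<in> faces l" "X \<in> faces l" "R \<in> faces l" "S \<in> faces l" "R \<le> S" "face_span l Y \<subseteq> \<pi>"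
    "face_span l R = \<pi>" "face_span l S = UNIV"
    using assms by (auto simp: fib_def max_fib_def int_faces_def)
  have "R \<circ>\<^sub>F Y = R" "S \<circ>\<^sub>F X = S" "R \<circ>\<^sub>F S = S"
    using * face_comp_absorb by (auto simp: face_le_iff_comp)
  then show ?thesis by (simp add: face_comp_assoc)
qed

text \<open>The unit is the pair of zero faces: composing [Y, X] with it on either side gives
  [Y, \<open>Y \<circ>\<^sub>F X\<close>], which is [Y, X] because Y \<le> X. It belongs to the
  fibre because the zero face spans the least flat.\<close>

lemma lrb_walk:
  assumes \<pi>: "\<pi> \<in> flats l" and w: "distribution_on (fib l \<pi>) w"
  shows "left_regular_band_walk (fib l \<pi>) (max_fib l \<pi>) (\<circ>\<^sub>I) (\<lambda>_. Zero, \<lambda>_. Zero) w"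
proof
  let ?S = "fib l \<pi>"
  have le: "fst x \<le> snd x" if "x \<in> ?S" for x using that by (auto simp: fib_def int_faces_def)
  show "finite ?S" by simp
  show "max_fib l \<pi> \<subseteq> ?S" by (rule max_fib_subset)
  show "x \<circ>\<^sub>I y \<in> ?S" if "x \<in> ?S" "y \<in> ?S" for x y
    using \<pi> that by (rule int_comp_mem_fib)
  show "x \<circ>\<^sub>I y \<circ>\<^sub>I z = x \<circ>\<^sub>I (y \<circ>\<^sub>I z)" for x y z by (rule int_comp_assoc)
  show "x \<circ>\<^sub>I y \<circ>\<^sub>I x = x \<circ>\<^sub>I y" for x y by (rule int_comp_left_regular)
  show "(\<lambda>_. Zero, \<lambda>_. Zero) \<in> ?S"
    using zero_face zero_face_span_subset[OF \<pi>] by (simp add: fib_def int_faces_def)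
  show "(\<lambda>_. Zero, \<lambda>_. Zero) \<circ>\<^sub>I x = x" if "x \<in> ?S" for x
    using le[OF that] by (cases x) (simp add: face_le_iff_comp)
  show "x \<circ>\<^sub>I (\<lambda>_. Zero, \<lambda>_. Zero) = x" if "x \<in> ?S" for x
    using le[OF that] by (cases x) (simp add: face_le_iff_comp)
  show "x \<circ>\<^sub>I c \<in> max_fib l \<pi>" if "x \<in> ?S" "c \<in> max_fib l \<pi>" for x c
    using \<pi> that by (rule int_comp_mem_max_fib)
  show "0 \<le> w x" if "x \<in> ?S" for x using w that by (simp add: distribution_on_def)
qed

text \<open>The chambers \<open>S\<close> to be counted lie above
  \<open>R \<circ>\<^sub>F X\<close>, whose span is the join of \<pi> and the span of
  \<open>X\<close> for every admissible \<open>R\<close>. The number of chambers is hence the same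
  for all \<open>R\<close>, and the count factors.\<close>

lemma card_max_fib_fixed:
  assumes \<pi>: "\<pi> \<in> flats l" and x: "(Y, X) \<in> fib l \<pi>"
  shows "int (card {c\<in>max_fib l \<pi>. (Y, X) \<circ>\<^sub>I c = c})
    = (\<Sum>(\<alpha>, \<beta>)\<in>{(\<alpha>, \<beta>)\<in>flat_pairs l \<pi>. face_span l Y \<subseteq> \<alpha> \<and> face_span l X \<subseteq> \<beta>}.
         \<bar>poset_moebius (flats l) \<alpha> \<pi> * poset_moebius (flats l) \<beta> UNIV\<bar>)"
proof -
  let ?\<mu> = "poset_moebius (flats l)"
  let ?A = "{\<alpha>\<in>flats l. face_span l Y \<subseteq> \<alpha> \<and> \<alpha> \<subseteq> \<pi>}"
  let ?B = "{\<beta>\<in>flats l. \<pi> \<subseteq> \<beta> \<and> face_span l X \<subseteq> \<beta>}"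
  let ?R = "{R\<in>faces l. Y \<le> R \<and> face_span l R = \<pi>}"
  let ?Ch = "\<lambda>R. {S\<in>faces l. R \<circ>\<^sub>F X \<le> S \<and> face_span l S = UNIV}"
  have YX: "Y \<in> faces l" "X \<in> faces l" "face_span l Y \<subseteq> \<pi>"
    using x by (auto simp: fib_def int_faces_def)
  have fixed: "(Y, X) \<circ>\<^sub>I (R, S) = (R, S) \<longleftrightarrow> Y \<le> R \<and> R \<circ>\<^sub>F X \<le> S" for R S
    by (auto simp: face_le_iff_comp)
  have mono: "R \<le> S" if "R \<circ>\<^sub>F X \<le> S" for R S
    using face_le_comp that by (rule order_trans)
  have "{c\<in>max_fib l \<pi>. (Y, X) \<circ>\<^sub>I c = c} = Sigma ?R ?Ch"
    by (auto simp: max_fib_def int_faces_def fixed intro: mono simp del: int_comp.simps)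
  then have "int (card {c\<in>max_fib l \<pi>. (Y, X) \<circ>\<^sub>I c = c}) = (\<Sum>R\<in>?R. int (card (?Ch R)))"
    by simp
  also have "\<dots> = (\<Sum>R\<in>?R. \<Sum>\<beta>\<in>?B. \<bar>?\<mu> \<beta> UNIV\<bar>)"
  proof (rule sum.cong[OF refl])
    fix R assume R: "R \<in> ?R"
    have RX: "R \<circ>\<^sub>F X \<in> faces l" using R YX by (simp add: faces_comp)
    have "face_span l (R \<circ>\<^sub>F X) \<subseteq> \<gamma> \<longleftrightarrow> \<pi> \<subseteq> \<gamma> \<and> face_span l X \<subseteq> \<gamma>" if "\<gamma> \<in> flats l" for \<gamma>
      using face_span_comp_subset_iff[OF that, of R X] R YX by simp
    then have "{\<gamma>\<in>flats l. face_span l (R \<circ>\<^sub>F X) \<subseteq> \<gamma> \<and> \<gamma> \<subseteq> UNIV} = ?B"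
      by (simp cong: conj_cong)
    then show "int (card (?Ch R)) = (\<Sum>\<beta>\<in>?B. \<bar>?\<mu> \<beta> UNIV\<bar>)"
      using card_faces_above[OF RX UNIV_flat] by simp
  qed
  also have "\<dots> = (\<Sum>\<alpha>\<in>?A. \<bar>?\<mu> \<alpha> \<pi>\<bar>) * (\<Sum>\<beta>\<in>?B. \<bar>?\<mu> \<beta> UNIV\<bar>)"
    using card_faces_above[OF YX(1) \<pi> YX(3)] by simp
  also have "\<dots> = (\<Sum>(\<alpha>, \<beta>)\<in>?A \<times> ?B. \<bar>?\<mu> \<alpha> \<pi> * ?\<mu> \<beta> UNIV\<bar>)"
    by (simp add: sum_product sum.cartesian_product abs_mult)
  also have "?A \<times> ?B = {(\<alpha>, \<beta>)\<in>flat_pairs l \<pi>. face_span l Y \<subseteq> \<alpha> \<and> face_span l X \<subseteq> \<beta>}"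
    by (auto simp: flat_pairs_def)
  finally show ?thesis .
qed

end

text \<open>Multiplicity is the order of a root of the characteristic polynomial. Since distinct
  pairs may share a value, the contributions of all pairs with that value are added.\<close>

theorem theorem4p11:
  fixes l :: "'t::finite \<Rightarrow> real^'d \<Rightarrow> real"
    and \<pi> :: "(real^'d) set"
    and w :: "'t face_interval \<Rightarrow> real"
    and cs :: "'t face_interval list"
  assumes "arrangement l"
    and "essential l"
    and "\<pi> \<in> flats l"
    and "distribution_on (fib l \<pi>) w"
    and "distinct cs" and "set cs = max_fib l \<pi>"
  shows "diagonalizable (walk_matrix l \<pi> w cs)
    \<and> (\<forall>(\<alpha>, \<beta>)\<in>flat_pairs l \<pi>.
          eigenvalue (walk_matrix l \<pi> w cs) (walk_eigenvalue l \<pi> w \<alpha> \<beta>))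
    \<and> (\<forall>(\<alpha>, \<beta>)\<in>flat_pairs l \<pi>.
          int (Polynomial.order (walk_eigenvalue l \<pi> w \<alpha> \<beta>) (char_poly (walk_matrix l \<pi> w cs)))
          = (\<Sum>(\<alpha>', \<beta>')\<in>{(\<alpha>', \<beta>')\<in>flat_pairs l \<pi>.
                 walk_eigenvalue l \<pi> w \<alpha>' \<beta>' = walk_eigenvalue l \<pi> w \<alpha> \<beta>}.
               \<bar>poset_moebius (flats l) \<alpha>' \<pi> * poset_moebius (flats l) \<beta>' UNIV\<bar>))
    \<and> (\<forall>e. eigenvalue (walk_matrix l \<pi> w cs) e
          \<longrightarrow> (\<exists>(\<alpha>, \<beta>)\<in>flat_pairs l \<pi>. e = walk_eigenvalue l \<pi> w \<alpha> \<beta>))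
    \<and> (generated_semigroup {x \<in> fib l \<pi>. w x > 0} = fib l \<pi>
          \<longrightarrow> (\<exists>!p. stationary l \<pi> w p))"
proof -
  interpret real_arrangement l
    using assms(1) by (intro real_arrangement.intro) (simp add: arrangement_def)
  let ?S = "fib l \<pi>" and ?C = "max_fib l \<pi>"
  interpret W: left_regular_band_walk_matrix ?S ?C "(\<circ>\<^sub>I)" "(\<lambda>_. Zero, \<lambda>_. Zero)" w cs
    using lrb_walk[OF assms(3,4)] assms(5,6)
    by (intro left_regular_band_walk_matrix.intro left_regular_band_walk_matrix_axioms.intro)
  let ?\<mu> = "poset_moebius (flats l)"
  let ?M = "walk_matrix l \<pi> w cs"
  let ?I = "flat_pairs l \<pi>"
  define ev where "ev i = walk_eigenvalue l \<pi> w (fst i) (snd i)" for i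
  define m where "m i = nat \<bar>?\<mu> (fst i) \<pi> * ?\<mu> (snd i) UNIV\<bar>" for i
  define below where "below x i \<longleftrightarrow> face_span l (fst x) \<subseteq> fst i \<and> face_span l (snd x) \<subseteq> snd i"
    for x :: "'t face_interval" and i
  have M: "?M = W.matrix"
    by (simp add: walk_matrix_def W.matrix_def walk_prob_def W.transition_def)
  have fin: "finite ?I"
    by (rule finite_subset[of _ "flats l \<times> flats l"]) (auto simp: flat_pairs_def finite_flats)
  have ev_below: "(\<Sum>x\<in>{x\<in>?S. below x i}. w x) = ev i" for i
    unfolding ev_def walk_eigenvalue_def below_def
    by (intro sum.cong refl Collect_cong) (auto split: prod.splits)
  have order: "Polynomial.order e (char_poly ?M) = (\<Sum>i\<in>{i\<in>?I. ev i = e}. m i)" for e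
    unfolding M ev_below[symmetric]
  proof (rule W.order_char_poly_matrix[OF fin])
    fix x y i assume "x \<in> ?S" "y \<in> ?S" "i \<in> ?I"
    then show "below (x \<circ>\<^sub>I y) i \<longleftrightarrow> below x i \<and> below y i"
      by (cases x; cases y; cases i)
         (auto simp: below_def fib_def int_faces_def flat_pairs_def faces_comp face_span_comp_subset_iff)
  next
    fix i assume "i \<in> ?I"
    then show "below (\<lambda>_. Zero, \<lambda>_. Zero) i"
      by (cases i) (simp add: below_def flat_pairs_def zero_face_span_subset)
  next
    fix s assume s: "s \<in> ?S"
    obtain Y X where YX: "s = (Y, X)" by (cases s)
    have "int (card {c\<in>?C. s \<circ>\<^sub>I c = c}) = (\<Sum>(\<alpha>, \<beta>)\<in>{i\<in>?I. below s i}. \<bar>?\<mu> \<alpha> \<pi> * ?\<mu> \<beta> UNIV\<bar>)"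
      using card_max_fib_fixed[OF assms(3) s[unfolded YX]] unfolding YX
      by (simp only: below_def split_def fst_conv snd_conv prod.collapse)
    also have "\<dots> = int (\<Sum>i\<in>{i\<in>?I. below s i}. m i)"
      unfolding of_nat_sum by (rule sum.cong[OF refl]) (simp add: m_def split_def)
    finally show "card {c\<in>?C. s \<circ>\<^sub>I c = c} = (\<Sum>i\<in>{i\<in>?I. below s i}. m i)"
      by (simp only: of_nat_eq_iff)
  qed
  \<comment> \<open>Rota's signs are strict, so neither Moebius value is 0 and every pair
    contributes a genuine eigenvalue.\<close>
  have m_pos: "m i > 0" if i: "i \<in> ?I" for i
  proof -
    have "?\<mu> (fst i) \<pi> \<noteq> 0" "?\<mu> (snd i) UNIV \<noteq> 0"
      using i moebius_flats_sign[of "fst i" \<pi>] moebius_flats_sign[of "snd i" UNIV] assms(3) UNIV_flat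
      by (auto simp: flat_pairs_def)
    then show ?thesis by (simp add: m_def)
  qed
  have carrier: "?M \<in> carrier_mat (length cs) (length cs)" unfolding M by (rule W.matrix_carrier)
  have char0: "char_poly ?M \<noteq> 0" using degree_monic_char_poly[OF carrier] by auto
  have eigenvalue_iff: "eigenvalue ?M e \<longleftrightarrow> (\<exists>i\<in>?I. ev i = e)" for e
  proof -
    have "eigenvalue ?M e \<longleftrightarrow> (\<Sum>i\<in>{i\<in>?I. ev i = e}. m i) \<noteq> 0"
      unfolding eigenvalue_root_char_poly[OF carrier] order_root order using char0 by simp
    also have "\<dots> \<longleftrightarrow> (\<exists>i\<in>{i\<in>?I. ev i = e}. m i \<noteq> 0)"
      using fin by simp
    also have "\<dots> \<longleftrightarrow> (\<exists>i\<in>?I. ev i = e)"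
      using m_pos by force
    finally show ?thesis .
  qed
  have "diagonalizable ?M" unfolding M by (rule W.diagonalizable_matrix)
  moreover have "\<forall>(\<alpha>, \<beta>)\<in>?I. eigenvalue ?M (walk_eigenvalue l \<pi> w \<alpha> \<beta>)"
    using eigenvalue_iff by (force simp: ev_def)
  moreover have "\<forall>(\<alpha>, \<beta>)\<in>?I.
      int (Polynomial.order (walk_eigenvalue l \<pi> w \<alpha> \<beta>) (char_poly ?M))
      = (\<Sum>(\<alpha>', \<beta>')\<in>{(\<alpha>', \<beta>')\<in>?I. walk_eigenvalue l \<pi> w \<alpha>' \<beta>' = walk_eigenvalue l \<pi> w \<alpha> \<beta>}.
           \<bar>?\<mu> \<alpha>' \<pi> * ?\<mu> \<beta>' UNIV\<bar>)"
    unfolding order by (simp add: ev_def m_def split_def)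
  moreover have "\<forall>e. eigenvalue ?M e \<longrightarrow> (\<exists>(\<alpha>, \<beta>)\<in>?I. e = walk_eigenvalue l \<pi> w \<alpha> \<beta>)"
    unfolding eigenvalue_iff by (auto simp: ev_def split_def)
  moreover have "\<exists>!p. stationary l \<pi> w p" if gen: "generated_semigroup {x\<in>?S. w x > 0} = ?S"
  proof -
    have stat: "stationary l \<pi> w p \<longleftrightarrow> distribution_on ?C p \<and> W.invariant p" for p
      by (simp add: stationary_def W.invariant_def walk_prob_def W.transition_def)
    \<comment> \<open>A maximal element exists because the top pair gives a root of the
      characteristic polynomial, which would be constant for an empty matrix.\<close>
    have "(\<pi>, UNIV) \<in> ?I" using assms(3) UNIV_flat by (auto simp: flat_pairs_def)
    then have root: "poly (char_poly ?M) (ev (\<pi>, UNIV)) = 0"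
      using eigenvalue_iff eigenvalue_root_char_poly[OF carrier] by blast
    have "length cs \<noteq> 0"
    proof
      assume "length cs = 0"
      then have "degree (char_poly ?M) = 0" using degree_monic_char_poly[OF carrier] by simp
      then obtain a where "char_poly ?M = [:a:]" by (rule degree_eq_zeroE)
      then show False using root char0 by simp
    qed
    then obtain c\<^sub>0 where c0: "c\<^sub>0 \<in> ?C" using assms(6) by (cases cs) auto
    have reach: "u (x \<circ>\<^sub>I c) > 0"
      if "x \<in> generated_semigroup {x\<in>?S. w x > 0}" and u: "W.invariant u" "\<And>c. c \<in> ?C \<Longrightarrow> 0 \<le> u c"
        and "c \<in> ?C" "u c > 0" for u x c
      using that(1,4,5)
    proof (induction arbitrary: c rule: generated_semigroup.induct)
      case (base x)
      then show ?case using W.invariant_pos_closed[OF u] by auto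
    next
      case (mult x y)
      have xy: "x \<in> ?S" "y \<in> ?S" using mult.hyps gen by auto
      then have "y \<circ>\<^sub>I c \<in> ?C" using mult.prems W.ideal by auto
      then have "u (x \<circ>\<^sub>I (y \<circ>\<^sub>I c)) > 0" using mult by auto
      then show ?case by (simp only: int_comp_assoc)
    qed
    have "u c\<^sub>0 > 0" if "W.invariant u" "\<And>c. c \<in> ?C \<Longrightarrow> 0 \<le> u c" "c \<in> ?C" "u c > 0" for u c
    proof -
      \<comment> \<open>The state \<open>c\<^sub>0\<close> is itself a product of elements of
        positive weight and absorbs every \<open>c\<close> on its right, so the walk can reach it
        from any state.\<close>
      have "c\<^sub>0 \<in> generated_semigroup {x\<in>?S. w x > 0}" using gen c0 W.C_subset by auto
      then have "u (c\<^sub>0 \<circ>\<^sub>I c) > 0" using that by (rule reach)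
      moreover have "c\<^sub>0 \<circ>\<^sub>I c = c\<^sub>0"
        by (rule max_fib_absorb[OF c0]) (use that(3) W.C_subset in blast)
      ultimately show ?thesis by simp
    qed
    then show ?thesis unfolding stat using assms(4) c0
      by (intro W.unique_invariant_distribution) (auto simp: distribution_on_def)
  qed
  ultimately show ?thesis by blast
qed

end
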